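(* Let $S$ be a $d\times d$ parity indicative symmetric matrix. Let $K=2d-\operatorname{rank}(S)$, and let $\alpha\in\mathbb{Z}_2^K$ be a nonzero vector with $\|\alpha\|_0\equiv\operatorname{Tr}(S)\pmod 2$. (1) Suppose $\operatorname{diag}(S)\ne\vec 0$. (a) If $\operatorname{rank}(S)=d$, there exists a (minimal) $K$-element frame $\mathcal{F}$ such that $S=\Theta_{\mathcal{F}}\Theta_{\mathcal{F}}^*$ and $(f_i,f_i)=\alpha[i]$ for every $i$ only if $\|\alpha\|_0=K$. (b) If $\operatorname{rank}(S)<d$, there exists a (minimal) $K$-element frame $\mathcal{F}$ such that $S=\Theta_{\mathcal{F}}\Theta_{\mathcal{F}}^*$ and $(f_i,f_i)=\alpha[i]$ for every $i$. (2) Suppose $\operatorname{diag}(S)=\vec 0$. Then $\operatorname{rank}(S)<d$. (a) If $\operatorname{rank}(S)=d-1$, there exists a (minimal) $K$-element frame $\mathcal{F}$ such that $S=\Theta_{\mathcal{F}}\Theta_{\mathcal{F}}^*$ and $(f_i,f_i)=\alpha[i]$ for every $i$ only if $\|\alpha\|_0=K$. (b) If $\operatorname{rank}(S)<d-1$, there exists a (minimal) $K$-element frame $\mathcal{F}$ such that $S=\Theta_{\mathcal{F}}\Theta_{\mathcal{F}}^*$ and $(f_i,f_i)=\alpha[i]$ for every $i$.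
   Context: All vectors and matrices have entries in the two-element field $\mathbb{Z}_2$ and all operations (including rank) are over $\mathbb{Z}_2$; $d\ge 1$. $\operatorname{Tr}$ is the trace. The dot product is $(a,b)=\sum_n a[n]b[n]$. Frame means binary frame: a $K$-element frame $\mathcal{F}=\{f_i\}_{i=1}^K$ for $\mathbb{Z}_2^d$ is a sequence of $K$ vectors (repetitions and zero vectors allowed) whose span is $\mathbb{Z}_2^d$. Its synthesis operator $\Theta_{\mathcal{F}}$ is the $d\times K$ matrix whose $i$th column is $f_i$, $^*$ denotes transpose, and $\Theta_{\mathcal{F}}\Theta_{\mathcal{F}}^*$ is its frame operator. A frame with frame operator $S$ is minimal if it has the fewest elements among all frames for $\mathbb{Z}_2^d$ with frame operator $S$. $\|\alpha\|_0$ is the number of nonzero entries of $\alpha$; $\operatorname{diag}(S)$ is the vector of diagonal entries of $S$; $\vec 0$ is the zero vector. A vector $v$ is even if $(v,v)=0$ (equivalently, $\|v\|_0$ is even) and odd otherwise. A $d\times d$ symmetric matrix $S$ is parity indicative if, for every $1\le i\le d$, $S_{ii}=1$ if and only if the $i$th row of $S$ is odd. *)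

theory Defs
  imports
    "HOL-Library.Z2"
    "Jordan_Normal_Form.DL_Rank"
begin

text \<open>
  The field with two elements is \<^typ>\<open>bit\<close>. Vectors and matrices are those of
  Jordan_Normal_Form, with 0-based indices. A \<open>K\<close>-element frame is a list of length \<open>K\<close>.
\<close>

definition binary_frame :: "nat \<Rightarrow> bit vec list \<Rightarrow> bool" where
  "binary_frame d fs \<longleftrightarrow>
     set fs \<subseteq> carrier_vec d \<and>
     LinearCombinations.module.span class_ring (module_vec TYPE(bit) d) (set fs) = carrier_vec d"

definition synthesis_operator :: "nat \<Rightarrow> bit vec list \<Rightarrow> bit mat" where
  "synthesis_operator d fs = mat_of_cols d fs"

definition frame_operator :: "nat \<Rightarrow> bit vec list \<Rightarrow> bit mat" where
  "frame_operator d fs = synthesis_operator d fs * transpose_mat (synthesis_operator d fs)"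

definition minimal_frame :: "nat \<Rightarrow> bit vec list \<Rightarrow> bool" where
  "minimal_frame d fs \<longleftrightarrow>
     binary_frame d fs \<and>
     (\<forall>gs. binary_frame d gs \<and> frame_operator d gs = frame_operator d fs
        \<longrightarrow> length fs \<le> length gs)"

definition norm0 :: "bit vec \<Rightarrow> nat" where
  "norm0 v = card {i. i < dim_vec v \<and> v $ i \<noteq> 0}"

definition diag_vec :: "bit mat \<Rightarrow> bit vec" where
  "diag_vec S = vec (dim_row S) (\<lambda>i. S $$ (i, i))"

definition trace_mat :: "bit mat \<Rightarrow> bit" where
  "trace_mat S = (\<Sum>i<dim_row S. S $$ (i, i))"

definition even_vec :: "bit vec \<Rightarrow> bool" where
  "even_vec v \<longleftrightarrow> v \<bullet> v = 0"

definition parity_indicative :: "bit mat \<Rightarrow> bool" where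
  "parity_indicative S \<longleftrightarrow>
     (\<forall>i < dim_row S. S $$ (i, i) = 1 \<longleftrightarrow> \<not> even_vec (row S i))"

end

theory Submission
  imports Defs "Jordan_Normal_Form.Matrix_Kernel"
begin

text \<open>
  View a frame through the rows of its synthesis operator \<open>\<Theta>\<close>: a frame of length \<open>N\<close> with frame
  operator \<open>S\<close> is a list of \<open>d\<close> linearly independent vectors in \<open>\<int>\<^sub>2\<^sup>N\<close> whose Gram matrix is \<open>S\<close>, and
  the parities \<open>(f\<^sub>n, f\<^sub>n)\<close> of the frame vectors are the entries of the sum \<open>\<alpha>\<close> of these rows. Let
  \<open>W\<close> be the row space. Its radical \<open>W \<inter> W\<^sup>\<bottom>\<close> is the image of the kernel of \<open>S\<close>, of dimension
  \<open>d - rank S\<close>, while \<open>W\<^sup>\<bottom>\<close> has dimension \<open>N - d\<close>. Hence \<open>N \<ge> 2 d - rank S\<close>, and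
  \<open>W\<^sup>\<bottom> \<subseteq> W\<close> gives equality (\<open>gram_factor_length\<close>); so every frame of length \<open>K\<close> is minimal.

  Parity indicativeness of \<open>S\<close> is the statement that \<open>\<beta> = 1 + \<alpha>\<close> belongs to \<open>W\<^sup>\<bottom>\<close>
  (\<open>column_sum_plus_one_orthogonal\<close>). When \<open>K = d\<close> this space is zero, and when \<open>K = d + 1\<close> and the
  diagonal of \<open>S\<close> vanishes it contains only \<open>0\<close> and \<open>1\<close>; since \<open>\<alpha> \<noteq> 0\<close>, both cases force
  \<open>\<alpha> = 1\<close> (\<open>frame_norms_all_one\<close>).

  Existence has three ingredients. A factorization with \<open>W\<^sup>\<bottom> \<subseteq> W\<close> is obtained from a wasteful one
  by deleting columns as long as some vector of \<open>W\<^sup>\<bottom>\<close> lies outside \<open>W\<close> (\<open>gram_factor_shrink\<close>,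
  \<open>saturated_gram_factor_subset\<close>). Then, adding an element of the radical to a single row changes
  \<open>\<beta>\<close> to any element of \<open>W\<^sup>\<bottom>\<close> other than \<open>1\<close> without affecting the Gram matrix
  (\<open>gram_factor_column_sum_orthogonal\<close>). Finally, isometries of \<open>\<int>\<^sub>2\<^sup>K\<close> act transitively on
  nonconstant vectors of even weight, two transvections being enough
  (\<open>gram_factor_move_column_sum_pair\<close>). The trace condition on \<open>\<alpha>\<close> says that the desired \<open>\<beta>\<close> has
  even weight, and the hypotheses on rank and diagonal provide a nonconstant vector of \<open>W\<^sup>\<bottom>\<close> to
  start from.
\<close>

section \<open>Gram factorizations over the field with two elements\<close>

definition dot :: "'n set \<Rightarrow> ('n \<Rightarrow> bit) \<Rightarrow> ('n \<Rightarrow> bit) \<Rightarrow> bit" where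
  "dot I x y = (\<Sum>n\<in>I. x n * y n)"

definition combine :: "nat \<Rightarrow> (nat \<Rightarrow> 'n \<Rightarrow> bit) \<Rightarrow> (nat \<Rightarrow> bit) \<Rightarrow> 'n \<Rightarrow> bit" where
  "combine d r c = (\<lambda>n. \<Sum>i<d. c i * r i n)"

definition rows_independent :: "nat \<Rightarrow> 'n set \<Rightarrow> (nat \<Rightarrow> 'n \<Rightarrow> bit) \<Rightarrow> bool" where
  "rows_independent d I r \<longleftrightarrow> (\<forall>c. (\<forall>n\<in>I. combine d r c n = 0) \<longrightarrow> (\<forall>i<d. c i = 0))"

text \<open>
  With \<open>\<Theta>\<close> the matrix whose rows are \<open>r 0, \<dots>, r (d - 1)\<close> and whose columns are indexed by \<open>I\<close>,
  this says \<open>\<Theta> \<Theta>\<^sup>* = S\<close> and \<open>\<Theta>\<^sup>*\<close> injective. The index set is arbitrary because the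
  shrinking step below deletes columns; renumbering is postponed to the end. Only values of \<open>r i\<close>
  on \<open>I\<close> matter.
\<close>
definition gram_factor :: "nat \<Rightarrow> (nat \<Rightarrow> nat \<Rightarrow> bit) \<Rightarrow> 'n set \<Rightarrow> (nat \<Rightarrow> 'n \<Rightarrow> bit) \<Rightarrow> bool" where
  "gram_factor d S I r \<longleftrightarrow>
     finite I \<and> (\<forall>i<d. \<forall>j<d. dot I (r i) (r j) = S i j) \<and> rows_independent d I r"

definition row_orthogonal :: "nat \<Rightarrow> 'n set \<Rightarrow> (nat \<Rightarrow> 'n \<Rightarrow> bit) \<Rightarrow> ('n \<Rightarrow> bit) \<Rightarrow> bool" where
  "row_orthogonal d I r z \<longleftrightarrow> (\<forall>i<d. dot I (r i) z = 0)"

definition in_row_space :: "nat \<Rightarrow> 'n set \<Rightarrow> (nat \<Rightarrow> 'n \<Rightarrow> bit) \<Rightarrow> ('n \<Rightarrow> bit) \<Rightarrow> bool" where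
  "in_row_space d I r z \<longleftrightarrow> (\<exists>c. \<forall>n\<in>I. z n = combine d r c n)"

text \<open>
  Writing \<open>W\<close> for the row space, this is \<open>W\<^sup>\<bottom> \<subseteq> W\<close>. Since \<open>W \<inter> W\<^sup>\<bottom>\<close> has dimension
  \<open>d - rank S\<close> for every Gram factorization of \<open>S\<close>, it is the shape that
  minimality takes: the complement has no room outside \<open>W\<close>.
\<close>
definition saturated :: "nat \<Rightarrow> 'n set \<Rightarrow> (nat \<Rightarrow> 'n \<Rightarrow> bit) \<Rightarrow> bool" where
  "saturated d I r \<longleftrightarrow> (\<forall>z. row_orthogonal d I r z \<longrightarrow> in_row_space d I r z)"

text \<open>
  The default rules rewrite field operations on bits to bit operations, which would hide the linear
  structure from the rules for sums.
\<close>
declare add_bit_eq_xor [simp del] mult_bit_eq_and [simp del]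

lemma bit_add_self [simp]: "(x::bit) + x = 0"
  by (cases x) simp_all

lemma bit_add_self_left [simp]: "(x::bit) + (x + y) = y"
  by (cases x; cases y) simp_all

lemma bit_mult_self [simp]: "(x::bit) * x = x"
  by (cases x) simp_all

lemma bit_add_eq_0_iff: "(x::bit) + y = 0 \<longleftrightarrow> x = y"
  by (cases x; cases y) simp_all

lemma dot_commute: "dot I x y = dot I y x"
  by (simp add: dot_def mult.commute)

lemma dot_cong: "(\<And>n. n \<in> I \<Longrightarrow> x n = x' n) \<Longrightarrow> (\<And>n. n \<in> I \<Longrightarrow> y n = y' n) \<Longrightarrow> dot I x y = dot I x' y'"
  by (simp add: dot_def)

lemma dot_add_left: "dot I (\<lambda>n. x n + y n) z = dot I x z + dot I y z"
  by (simp add: dot_def algebra_simps sum.distrib)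

lemma dot_add_right: "dot I z (\<lambda>n. x n + y n) = dot I z x + dot I z y"
  by (simp add: dot_def algebra_simps sum.distrib)

lemma dot_scale_left: "dot I (\<lambda>n. a * x n) z = a * dot I x z"
  by (simp add: dot_def algebra_simps sum_distrib_left)

lemma dot_scale_right: "dot I z (\<lambda>n. a * x n) = a * dot I z x"
  by (simp add: dot_def algebra_simps sum_distrib_left)

lemmas dot_linear = dot_add_left dot_add_right dot_scale_left dot_scale_right

lemma dot_one: "dot I x (\<lambda>_. 1) = dot I x x"
  by (simp add: dot_def)

lemma dot_one_left: "dot I (\<lambda>_. 1) x = dot I x x"
  by (simp add: dot_def)

lemma dot_combine_left: "dot I (combine d r c) y = (\<Sum>i<d. c i * dot I (r i) y)"
proof -
  have "dot I (combine d r c) y = (\<Sum>n\<in>I. \<Sum>i<d. c i * (r i n * y n))"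
    by (simp add: dot_def combine_def sum_distrib_right mult.assoc)
  also have "\<dots> = (\<Sum>i<d. \<Sum>n\<in>I. c i * (r i n * y n))"
    by (rule sum.swap)
  finally show ?thesis
    by (simp add: dot_def sum_distrib_left)
qed

lemma combine_add: "combine d r (\<lambda>i. a i + b i) n = combine d r a n + combine d r b n"
  by (simp add: combine_def algebra_simps sum.distrib)

lemma combine_scale: "combine d r (\<lambda>i. k * a i) n = k * combine d r a n"
  by (simp add: combine_def sum_distrib_left mult.assoc)

lemma combine_zero: "combine d r (\<lambda>_. 0) n = 0"
  by (simp add: combine_def)

lemma dot_row_space_orthogonal:
  assumes "row_orthogonal d I r z" "in_row_space d I r y"
  shows "dot I y z = 0"
proof -
  obtain c where "\<forall>n\<in>I. y n = combine d r c n"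
    using assms(2) by (auto simp: in_row_space_def)
  then have "dot I y z = dot I (combine d r c) z"
    by (intro dot_cong) auto
  then show ?thesis
    using assms(1) by (simp add: dot_combine_left row_orthogonal_def)
qed

text \<open>
  The radical of the row space corresponds to the kernel of \<open>S\<close>, as \<open>\<Theta> \<Theta>\<^sup>* c = S c\<close>.
\<close>
lemma orthogonal_combine_iff:
  assumes "gram_factor d S I r"
  shows "row_orthogonal d I r (combine d r c) \<longleftrightarrow> (\<forall>i<d. (\<Sum>j<d. S i j * c j) = 0)"
proof -
  have "dot I (r i) (combine d r c) = (\<Sum>j<d. S i j * c j)" if "i < d" for i
    using assms that
    by (subst dot_commute, subst dot_combine_left, subst dot_commute)
       (auto intro!: sum.cong simp: gram_factor_def mult.commute)
  then show ?thesis
    by (simp add: row_orthogonal_def)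
qed

definition point :: "'n \<Rightarrow> 'n \<Rightarrow> bit" where
  "point p = (\<lambda>n. of_bool (n = p))"

lemma dot_point: "finite I \<Longrightarrow> p \<in> I \<Longrightarrow> dot I x (point p) = x p"
  by (simp add: dot_def point_def of_bool_def if_distrib[of "\<lambda>t. _ * t"] sum.delta cong: if_cong)

section \<open>Transvections\<close>

text \<open>
  All isometries of \<open>\<int>\<^sub>2\<^sup>I\<close> that the argument uses are of this form. For \<open>(v, v) = 0\<close> this map is an
  involutive isometry, and since \<open>(1, v) = (v, v)\<close> it fixes the all-one vector.
\<close>
definition transvection :: "'n set \<Rightarrow> ('n \<Rightarrow> bit) \<Rightarrow> ('n \<Rightarrow> bit) \<Rightarrow> 'n \<Rightarrow> bit" where
  "transvection I v x = (\<lambda>n. x n + dot I x v * v n)"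

lemma transvection_isometry:
  assumes "dot I v v = 0"
  shows "dot I (transvection I v x) (transvection I v y) = dot I x y"
  using assms unfolding transvection_def dot_linear dot_commute[of I v y]
  by (cases "dot I x v"; cases "dot I y v") simp_all

lemma transvection_involution:
  assumes "dot I v v = 0"
  shows "transvection I v (transvection I v x) = x"
  using assms by (simp add: transvection_def dot_linear fun_eq_iff add.assoc)

lemma transvection_cong:
  assumes "\<And>n. n \<in> I \<Longrightarrow> x n = y n" "n \<in> I"
  shows "transvection I v x n = transvection I v y n"
  using assms dot_cong[of I x y v v] by (simp add: transvection_def)

lemma combine_transvection:
  "combine d (\<lambda>i. transvection I v (r i)) c = transvection I v (combine d r c)"
  by (simp add: fun_eq_iff transvection_def dot_combine_left)
     (simp add: combine_def algebra_simps sum.distrib sum_distrib_left)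

lemma transvection_add:
  "transvection I v (\<lambda>n. x n + y n) n = transvection I v x n + transvection I v y n"
  by (simp add: transvection_def dot_linear algebra_simps)

lemma transvection_zero: "(\<And>n. n \<in> I \<Longrightarrow> x n = 0) \<Longrightarrow> n \<in> I \<Longrightarrow> transvection I v x n = 0"
  by (simp add: transvection_def dot_def)

lemma transvection_one: "dot I v v = 0 \<Longrightarrow> transvection I v (\<lambda>_. 1) = (\<lambda>_. 1)"
  by (simp add: transvection_def dot_one_left)

lemma gram_factor_transvection:
  assumes "gram_factor d S I r" "dot I v v = 0"
  shows "gram_factor d S I (\<lambda>i. transvection I v (r i))"
  unfolding gram_factor_def rows_independent_def
proof (intro conjI allI impI)
  show "finite I"
    using assms(1) by (simp add: gram_factor_def)
  show "dot I (transvection I v (r i)) (transvection I v (r j)) = S i j" if "i < d" "j < d" for i j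
    using assms that by (simp add: transvection_isometry gram_factor_def)
  fix c i
  assume "\<forall>n\<in>I. combine d (\<lambda>i. transvection I v (r i)) c n = 0" and i: "i < d"
  then have "transvection I v (transvection I v (combine d r c)) n = 0" if "n \<in> I" for n
    using that \<open>\<forall>n\<in>I. _ n = 0\<close>
    by (intro transvection_zero[of I "transvection I v (combine d r c)"])
       (simp_all add: combine_transvection)
  then have "\<forall>n\<in>I. combine d r c n = 0"
    by (simp add: transvection_involution[OF assms(2)])
  then show "c i = 0"
    using assms(1) i by (simp add: gram_factor_def rows_independent_def)
qed

text \<open>
  Two vectors of equal parity whose inner product differs from that parity are exchanged by the
  transvection along their sum.
\<close>
lemma transvection_moves:
  assumes "dot I z z = dot I u u" "dot I z u \<noteq> dot I z z"
  defines "v \<equiv> \<lambda>n. z n + u n"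
  shows "dot I v v = 0" "transvection I v z = u" "transvection I v u = z"
proof -
  have 1: "dot I z v = 1"
    using assms(2) unfolding v_def dot_linear
    by (cases "dot I z z"; cases "dot I z u") simp_all
  have 2: "dot I u v = 1"
    using assms(1,2) unfolding v_def dot_linear dot_commute[of I u z]
    by (cases "dot I z z"; cases "dot I z u") simp_all
  show "dot I v v = 0"
    using assms(1) unfolding v_def dot_linear dot_commute[of I u z]
    by (cases "dot I u u"; cases "dot I z u") simp_all
  show "transvection I v z = u" "transvection I v u = z"
    by (simp_all add: transvection_def 1 2) (simp_all add: v_def add.commute)
qed

section \<open>Shrinking a Gram factorization\<close>

text \<open>
  This is the column-elimination step. A vector \<open>z\<close> orthogonal to all rows but outside the row space
  is moved by a transvection to a vector \<open>u\<close> supported on one or two points, for odd and even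
  \<open>z\<close> respectively. The moved rows are orthogonal to \<open>u\<close>. If \<open>u\<close> is the point \<open>p\<close>, column \<open>p\<close> has become
  zero; if \<open>u\<close> is the pair \<open>p, q\<close>, columns \<open>p\<close> and \<open>q\<close> have become equal and their contributions
  to the Gram matrix cancel. Deleting a zero column is harmless; deleting the pair keeps the rows
  independent because \<open>u\<close> is not in the moved row space. A zero of \<open>z\<close> is required to find the point \<open>p\<close>.
\<close>
lemma gram_factor_shrink:
  assumes F: "gram_factor d S I r"
    and orth: "row_orthogonal d I r z" and notin: "\<not> in_row_space d I r z"
    and p: "p \<in> I" "z p = 0"
  shows "\<exists>J r'. J \<subset> I \<and> gram_factor d S J r'"
proof -
  have fin: "finite I"
    using F by (simp add: gram_factor_def)
  show ?thesis
  proof (cases "dot I z z = 1")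
    case True
    define u where "u = point p"
    define v where "v = (\<lambda>n. z n + u n)"
    define r' where "r' = (\<lambda>i. transvection I v (r i))"
    have uu: "dot I u u = 1" and zu: "dot I z u = 0"
      unfolding u_def dot_point[OF fin p(1)] by (simp_all add: point_def p)
    have v: "dot I v v = 0" "transvection I v z = u"
      unfolding v_def by (rule transvection_moves; simp add: uu zu True)+
    have F': "gram_factor d S I r'"
      unfolding r'_def by (rule gram_factor_transvection[OF F v(1)])
    have r'p: "r' i p = 0" if "i < d" for i
    proof -
      have "r' i p = dot I (r' i) u"
        by (simp add: u_def dot_point fin p)
      also have "\<dots> = dot I (r i) z"
        unfolding r'_def v(2)[symmetric] by (rule transvection_isometry[OF v(1)])
      finally show ?thesis
        using orth that by (simp add: row_orthogonal_def)
    qed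
    have "gram_factor d S (I - {p}) r'"
      unfolding gram_factor_def rows_independent_def
    proof (intro conjI allI impI)
      show "finite (I - {p})" using fin by simp
      show "dot (I - {p}) (r' i) (r' j) = S i j" if "i < d" "j < d" for i j
      proof -
        have "dot I (r' i) (r' j) = r' i p * r' j p + dot (I - {p}) (r' i) (r' j)"
          unfolding dot_def by (rule sum.remove[OF fin p(1)])
        then show ?thesis
          using F' that by (simp add: r'p gram_factor_def)
      qed
      fix c i assume c: "\<forall>n\<in>I - {p}. combine d r' c n = 0" and i: "i < d"
      have "combine d r' c p = 0"
        by (simp add: combine_def r'p)
      then have "\<forall>n\<in>I. combine d r' c n = 0"
        using c by blast
      then show "c i = 0"
        using F' i by (simp add: gram_factor_def rows_independent_def)
    qed
    then show ?thesis
      using p by blast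
  next
    case False
    then have zz: "dot I z z = 0"
      by simp
    have "\<exists>q\<in>I. z q = 1"
    proof (rule ccontr)
      assume "\<not> (\<exists>q\<in>I. z q = 1)"
      then have "\<forall>n\<in>I. z n = combine d r (\<lambda>_. 0) n"
        by (auto simp: combine_zero)
      then show False
        using notin by (auto simp: in_row_space_def)
    qed
    then obtain q where q: "q \<in> I" "z q = 1"
      by blast
    have pq: "p \<noteq> q"
      using p q by auto
    (* one point inside and one outside the support of z, so that (z, u) = 1 while both are even *)
    define u where "u = (\<lambda>n. point p n + point q n)"
    define v where "v = (\<lambda>n. z n + u n)"
    define r' where "r' = (\<lambda>i. transvection I v (r i))"
    have uI: "dot I x u = x p + x q" for x
      unfolding u_def dot_add_right by (simp add: dot_point fin p q)
    have uu: "dot I u u = 0" and zu: "dot I z u = 1"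
      unfolding uI by (simp_all add: u_def point_def p q pq pq[symmetric])
    have v: "dot I v v = 0" "transvection I v z = u" "transvection I v u = z"
      unfolding v_def by (rule transvection_moves; simp add: uu zu zz)+
    have F': "gram_factor d S I r'"
      unfolding r'_def by (rule gram_factor_transvection[OF F v(1)])
    have r'pq: "r' i p = r' i q" if "i < d" for i
    proof -
      have "r' i p + r' i q = dot I (r' i) u"
        by (simp add: uI)
      also have "\<dots> = dot I (r i) z"
        unfolding r'_def v(2)[symmetric] by (rule transvection_isometry[OF v(1)])
      finally show ?thesis
        using orth that by (simp add: row_orthogonal_def bit_add_eq_0_iff)
    qed
    have "gram_factor d S (I - {p} - {q}) r'"
      unfolding gram_factor_def rows_independent_def
    proof (intro conjI allI impI)
      show "finite (I - {p} - {q})" using fin by simp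
      show "dot (I - {p} - {q}) (r' i) (r' j) = S i j" if "i < d" "j < d" for i j
      proof -
        have "dot I (r' i) (r' j) = r' i p * r' j p + dot (I - {p}) (r' i) (r' j)"
          unfolding dot_def by (rule sum.remove[OF fin p(1)])
        also have "dot (I - {p}) (r' i) (r' j) = r' i q * r' j q + dot (I - {p} - {q}) (r' i) (r' j)"
          unfolding dot_def by (rule sum.remove) (use fin q pq in auto)
        finally show ?thesis
          using F' that by (simp add: r'pq gram_factor_def)
      qed
      fix c i assume c: "\<forall>n\<in>I - {p} - {q}. combine d r' c n = 0" and i: "i < d"
      have cpq: "combine d r' c p = combine d r' c q"
        by (simp add: combine_def r'pq)
      (* otherwise this combination is u on all of I, and moving back exhibits z in the row space *)
      have "combine d r' c q = 0"
      proof (rule ccontr)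
        assume "combine d r' c q \<noteq> 0"
        then have "combine d r' c n = u n" if "n \<in> I" for n
          using that c cpq pq by (cases "n = p \<or> n = q") (auto simp: u_def point_def)
        then have "transvection I v (combine d r' c) n = transvection I v u n" if "n \<in> I" for n
          using that by (intro transvection_cong)
        then have "combine d r c n = z n" if "n \<in> I" for n
          using that unfolding r'_def combine_transvection transvection_involution[OF v(1)] v(3)
          by simp
        then have "\<forall>n\<in>I. z n = combine d r c n"
          by simp
        then show False
          using notin unfolding in_row_space_def by blast
      qed
      then have "\<forall>n\<in>I. combine d r' c n = 0"
        using c cpq by auto
      then show "c i = 0"
        using F' i by (simp add: gram_factor_def rows_independent_def)
    qed
    moreover have "I - {p} - {q} \<subset> I"
      using p(1) by blast
    ultimately show ?thesis
      by blast
  qed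
qed

text \<open>
  Start from any factorization, however wasteful. With \<open>X\<close> the strict upper triangle of \<open>S\<close>, the
  blocks \<open>X\<close> and \<open>X + 1\<close> have Gram matrices summing to \<open>X + X\<^sup>* + 1\<close>, and a diagonal block
  corrects the diagonal. Independence comes for free: a relation holding in both \<open>X\<close> and \<open>X + 1\<close>
  holds in the identity matrix.
\<close>
lemma gram_factor_exists:
  assumes sym: "\<And>i j. i < d \<Longrightarrow> j < d \<Longrightarrow> S i j = S j i"
  shows "\<exists>(I :: (nat \<times> nat) set) r. gram_factor d S I r"
proof -
  define X where "X = (\<lambda>i n. if i < n then S i n else 0)"
  define \<delta> :: "nat \<Rightarrow> nat \<Rightarrow> bit" where "\<delta> = (\<lambda>i n. of_bool (i = n))"
  (* the + 1 in the last block cancels the identity matrix contributed by the first two *)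
  define r where "r = (\<lambda>i (k::nat, n). if k = 0 then X i n
      else if k = 1 then X i n + \<delta> i n else \<delta> i n * (S i i + 1))"
  let ?I = "{..<3::nat} \<times> {..<d}"
  have split3: "(\<Sum>a\<in>?I. g a) = (\<Sum>n<d. g (0, n) + g (1, n) + g (2, n))" for g :: "nat \<times> nat \<Rightarrow> bit"
  proof -
    have "(\<Sum>a\<in>?I. g a) = (\<Sum>k<3. \<Sum>n<d. g (k, n))"
      by (simp add: sum.cartesian_product)
    then show ?thesis
      by (simp add: numeral_3_eq_3 numeral_2_eq_2 sum.distrib)
  qed
  have delta: "(\<Sum>n<d. \<delta> i n * g n) = g i" if "i < d" for i g
  proof -
    have "(\<Sum>n<d. \<delta> i n * g n) = (\<Sum>n<d. if i = n then g n else 0)"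
      by (intro sum.cong) (auto simp: \<delta>_def)
    then show ?thesis
      using that by simp
  qed
  have "dot ?I (r i) (r j) = S i j" if ij: "i < d" "j < d" for i j
  proof -
    have "dot ?I (r i) (r j) = (\<Sum>n<d. X i n * X j n + (X i n + \<delta> i n) * (X j n + \<delta> j n)
        + (\<delta> i n * (S i i + 1)) * (\<delta> j n * (S j j + 1)))"
      unfolding dot_def split3 by (simp add: r_def)
    also have "\<dots> = (\<Sum>n<d. \<delta> j n * X i n + \<delta> i n * X j n + \<delta> i n * (of_bool (i = j) * S i i))"
    proof (rule sum.cong[OF refl])
      fix n
      show "X i n * X j n + (X i n + \<delta> i n) * (X j n + \<delta> j n)
          + (\<delta> i n * (S i i + 1)) * (\<delta> j n * (S j j + 1))
        = \<delta> j n * X i n + \<delta> i n * X j n + \<delta> i n * (of_bool (i = j) * S i i)"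
        by (cases "i = n"; cases "j = n"; cases "X i n"; cases "X j n"; cases "S i i"; cases "S j j")
           (simp_all add: \<delta>_def)
    qed
    also have "\<dots> = X i j + X j i + of_bool (i = j) * S i i"
      by (simp add: sum.distrib delta ij)
    also have "\<dots> = S i j"
      using sym[OF ij] by (cases i j rule: linorder_cases) (simp_all add: X_def)
    finally show ?thesis .
  qed
  moreover have "rows_independent d ?I r"
    unfolding rows_independent_def
  proof (intro allI impI)
    fix c i assume c: "\<forall>a\<in>?I. combine d r c a = 0" and i: "i < d"
    have "combine d r c (0, i) = 0" "combine d r c (1, i) = 0"
      using c i by auto
    then have "(\<Sum>k<d. c k * X k i) + (\<Sum>k<d. c k * (X k i + \<delta> k i)) = 0"
      by (simp add: combine_def r_def)
    then have "(\<Sum>k<d. c k * \<delta> k i) = 0"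
      by (simp add: algebra_simps sum.distrib)
    moreover have "(\<Sum>k<d. c k * \<delta> k i) = (\<Sum>k<d. \<delta> i k * c k)"
      by (intro sum.cong) (auto simp: \<delta>_def)
    ultimately show "c i = 0"
      using delta[OF i, of c] by simp
  qed
  ultimately have "gram_factor d S ?I r"
    by (simp add: gram_factor_def)
  then show ?thesis
    by blast
qed

text \<open>
  Shrinking as long as possible ends in a saturated factorization. The only obstruction could be that
  the all-one vector is the sole vector in the complement outside the row space; a kernel vector of
  \<open>S\<close> excludes this, since it yields a nonzero \<open>w\<close> in both spaces and \<open>1 + w\<close> is then another
  such vector, with a zero.
\<close>
lemma saturated_gram_factor_subset:
  assumes "gram_factor d S I r"
    and null: "\<And>i. i < d \<Longrightarrow> (\<Sum>j<d. S i j * c j) = 0" and c: "k < d" "c k \<noteq> 0"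
  shows "\<exists>J r'. J \<subseteq> I \<and> gram_factor d S J r' \<and> saturated d J r'"
  using assms(1)
proof (induction "card I" arbitrary: I r rule: less_induct)
  case less
  have fin: "finite I"
    using less.prems by (simp add: gram_factor_def)
  show ?case
  proof (cases "saturated d I r")
    case True
    then show ?thesis
      using less.prems by blast
  next
    case False
    then obtain z where z: "row_orthogonal d I r z" "\<not> in_row_space d I r z"
      by (auto simp: saturated_def)
    obtain z' p where z': "row_orthogonal d I r z'" "\<not> in_row_space d I r z'" and p: "p \<in> I" "z' p = 0"
    proof (cases "\<exists>p\<in>I. z p = 0")
      case True
      then show ?thesis
        using z that by blast
    next
      case False
      then have z1: "z n = 1" if "n \<in> I" for n
        using that by auto
      define w where "w = combine d r c"
      have w: "row_orthogonal d I r w"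
        unfolding w_def orthogonal_combine_iff[OF less.prems] using null by blast
      obtain p where p: "p \<in> I" "w p = 1"
        using less.prems c unfolding w_def gram_factor_def rows_independent_def by fastforce
      have "row_orthogonal d I r (\<lambda>n. z n + w n)"
        using z(1) w by (simp add: row_orthogonal_def dot_add_right)
      moreover have "\<not> in_row_space d I r (\<lambda>n. z n + w n)"
      proof
        assume "in_row_space d I r (\<lambda>n. z n + w n)"
        then obtain e where e: "\<forall>n\<in>I. z n + w n = combine d r e n"
          by (auto simp: in_row_space_def)
        have "\<forall>n\<in>I. z n = combine d r (\<lambda>i. e i + c i) n"
          using e by (auto simp: combine_add w_def[symmetric] add.assoc simp flip: e)
        then show False
          using z(2) by (auto simp: in_row_space_def)
      qed
      moreover have "z p + w p = 0"
        using p z1 by simp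
      ultimately show ?thesis
        using that p(1) by blast
    qed
    obtain J r' where J: "J \<subset> I" "gram_factor d S J r'"
      using gram_factor_shrink[OF less.prems z' p] by blast
    obtain J' r'' where "J' \<subseteq> J" "gram_factor d S J' r''" "saturated d J' r''"
      using less.hyps[OF psubset_card_mono[OF fin J(1)] J(2)] by blast
    then show ?thesis
      using J(1) by (intro exI[of _ J'] exI[of _ r'']) auto
  qed
qed

lemma gram_factor_reindex:
  assumes "gram_factor d S I r" "saturated d I r"
  shows "\<exists>r'. gram_factor d S {..<card I} r' \<and> saturated d {..<card I} r'"
proof -
  let ?N = "{..<card I}"
  have "finite I"
    using assms(1) by (simp add: gram_factor_def)
  then obtain h where h: "bij_betw h ?N I"
    using ex_bij_betw_nat_finite[of I] by (auto simp: atLeast0LessThan)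
  define r' where "r' = (\<lambda>i n. r i (h n))"
  have dot_h: "dot ?N (\<lambda>n. x (h n)) (\<lambda>n. y (h n)) = dot I x y" for x y
    unfolding dot_def by (rule sum.reindex_bij_betw[OF h])
  have combine_h: "combine d r' c n = combine d r c (h n)" for c n
    by (simp add: combine_def r'_def)
  have ball_h: "(\<forall>n\<in>?N. P (h n)) \<longleftrightarrow> (\<forall>n\<in>I. P n)" for P
  proof -
    have "(\<forall>n\<in>h ` ?N. P n) \<longleftrightarrow> (\<forall>n\<in>?N. P (h n))"
      by simp
    then show ?thesis
      by (simp only: bij_betw_imp_surj_on[OF h])
  qed
  have "gram_factor d S ?N r'"
    using assms(1) ball_h[of "\<lambda>n. combine d r _ n = 0"]
    by (simp add: gram_factor_def rows_independent_def combine_h) (simp add: r'_def dot_h)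
  moreover have "saturated d ?N r'"
    unfolding saturated_def
  proof (intro allI impI)
    fix z assume z: "row_orthogonal d ?N r' z"
    define y where "y = (\<lambda>n. z (the_inv_into ?N h n))"
    have y: "y (h n) = z n" if "n \<in> ?N" for n
      using h that by (simp add: y_def bij_betw_def the_inv_into_f_f)
    have "dot I (r i) y = dot ?N (r' i) z" for i
      unfolding dot_h[symmetric] r'_def using y by (intro dot_cong) auto
    then have "row_orthogonal d I r y"
      using z by (simp add: row_orthogonal_def)
    then obtain c where c: "\<forall>n\<in>I. y n = combine d r c n"
      using assms(2) by (auto simp: saturated_def in_row_space_def)
    have "\<forall>n\<in>?N. y (h n) = combine d r' c n"
      unfolding combine_h using c bij_betwE[OF h] by simp
    then show "in_row_space d ?N r' z"
      using y by (auto simp: in_row_space_def)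
  qed
  ultimately show ?thesis
    by blast
qed

section \<open>Prescribing the column sums\<close>

definition column_sum :: "nat \<Rightarrow> (nat \<Rightarrow> 'n \<Rightarrow> bit) \<Rightarrow> 'n \<Rightarrow> bit" where
  "column_sum d r = combine d r (\<lambda>_. 1)"

text \<open>
  Column sums are the parities \<open>(f\<^sub>n, f\<^sub>n)\<close> of the frame vectors. Parity indicativeness says that the
  sum \<open>s\<close> of all rows satisfies \<open>(r\<^sub>i, s) = (r\<^sub>i, r\<^sub>i) = (r\<^sub>i, 1)\<close>.
\<close>
lemma column_sum_plus_one_orthogonal:
  assumes F: "gram_factor d S I r" and parity: "\<And>i. i < d \<Longrightarrow> (\<Sum>j<d. S i j) = S i i"
  shows "row_orthogonal d I r (\<lambda>n. 1 + column_sum d r n)"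
  unfolding row_orthogonal_def
proof (intro allI impI)
  fix i assume i: "i < d"
  have "dot I (r i) (column_sum d r) = (\<Sum>j<d. dot I (r j) (r i))"
    by (subst dot_commute) (simp add: column_sum_def dot_combine_left)
  also have "\<dots> = (\<Sum>j<d. S i j)"
    using F i by (intro sum.cong) (auto simp: gram_factor_def dot_commute[of I _ "r i"])
  also have "\<dots> = dot I (r i) (r i)"
    using F i parity by (simp add: gram_factor_def)
  finally show "dot I (r i) (\<lambda>n. 1 + column_sum d r n) = 0"
    by (simp add: dot_add_right dot_one)
qed

text \<open>
  With \<open>s\<close> the sum of the rows, \<open>1 + s\<close> lies in the complement, hence by saturation in the radical,
  so it is isotropic and orthogonal to \<open>s\<close>; therefore \<open>(1, 1) = (s, s)\<close>. This links the parity of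
  the length to the trace.
\<close>
lemma dot_one_one_eq_trace:
  assumes F: "gram_factor d S I r" and sat: "saturated d I r"
    and parity: "\<And>i. i < d \<Longrightarrow> (\<Sum>j<d. S i j) = S i i"
  shows "dot I (\<lambda>_. 1) (\<lambda>_. 1) = (\<Sum>i<d. S i i)"
proof -
  define s where "s = column_sum d r"
  define b where "b = (\<lambda>n. 1 + s n)"
  have orth: "row_orthogonal d I r b"
    unfolding b_def s_def by (rule column_sum_plus_one_orthogonal[OF F parity])
  then have "in_row_space d I r b"
    using sat by (simp add: saturated_def)
  then have bb: "dot I b b = 0"
    by (rule dot_row_space_orthogonal[OF orth])
  have "in_row_space d I r s"
    by (auto simp: in_row_space_def s_def column_sum_def)
  then have sb: "dot I s b = 0"
    by (rule dot_row_space_orthogonal[OF orth])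
  have "(\<lambda>_. 1) = (\<lambda>n. s n + b n)"
    by (simp add: b_def fun_eq_iff add.left_commute)
  then have "dot I (\<lambda>_. 1) (\<lambda>_. 1) = dot I s s"
    by (simp add: dot_linear bb sb dot_commute[of I b s])
  also have "\<dots> = (\<Sum>i<d. dot I (r i) s)"
    unfolding s_def column_sum_def dot_combine_left by simp
  also have "\<dots> = (\<Sum>i<d. S i i)"
  proof (rule sum.cong[OF refl])
    fix i assume "i \<in> {..<d}"
    then have "dot I (r i) b = 0" "dot I (r i) (r i) = S i i"
      using orth F by (auto simp: row_orthogonal_def gram_factor_def)
    then show "dot I (r i) s = S i i"
      unfolding b_def dot_add_right dot_one by (simp add: bit_add_eq_0_iff)
  qed
  finally show ?thesis .
qed

text \<open>
  Adding to a single row \<open>r k\<close> a vector \<open>t\<close> of the radical leaves the Gram matrix unchanged and adds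
  \<open>t\<close> to the column sums. Writing \<open>t\<close> as the combination of the rows with coefficients \<open>a\<close>, the
  rows stay independent when \<open>a k = 0\<close>. Such a \<open>k\<close> exists unless \<open>t\<close> is the sum of all rows, which
  would make the new column sums vanish; the zero of \<open>b\<close> rules this out.
\<close>
lemma gram_factor_column_sum_orthogonal:
  assumes F: "gram_factor d S I r" and sat: "saturated d I r"
    and parity: "\<And>i. i < d \<Longrightarrow> (\<Sum>j<d. S i j) = S i i"
    and b: "row_orthogonal d I r b" and p: "p \<in> I" "b p = 0"
  shows "\<exists>r'. gram_factor d S I r' \<and> (\<forall>n\<in>I. column_sum d r' n = 1 + b n)"
proof -
  (* the difference between the present and the desired column sums *)
  define t where "t = (\<lambda>n. (1 + column_sum d r n) + b n)"
  have t: "row_orthogonal d I r t"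
    using column_sum_plus_one_orthogonal[OF F parity] b
    by (simp add: t_def row_orthogonal_def dot_add_right[of I _ _ b])
  then obtain a where a: "\<forall>n\<in>I. t n = combine d r a n"
    using sat by (auto simp: saturated_def in_row_space_def)
  have tt: "dot I t t = 0"
    using a by (intro dot_row_space_orthogonal[OF t]) (auto simp: in_row_space_def)
  have rt: "dot I (r i) t = 0" if "i < d" for i
    using t that by (simp add: row_orthogonal_def)
  have "\<exists>k<d. a k = 0"
  proof (rule ccontr)
    assume "\<not> (\<exists>k<d. a k = 0)"
    then have "combine d r a p = column_sum d r p"
      by (simp add: combine_def column_sum_def)
    then have "t p = column_sum d r p"
      using a p by simp
    then show False
      using p(2) by (cases "column_sum d r p") (simp_all add: t_def)
  qed
  then obtain k where k: "k < d" "a k = 0"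
    by blast
  define r' where "r' = (\<lambda>i n. r i n + of_bool (i = k) * t n)"
  have combine_r': "combine d r' c n = combine d r c n + c k * t n" for c n
  proof -
    have "(\<Sum>i<d. c i * (of_bool (i = k) * t n)) = (\<Sum>i<d. if i = k then c i * t n else 0)"
      by (intro sum.cong) auto
    then show ?thesis
      using k(1) by (simp add: combine_def r'_def algebra_simps sum.distrib)
  qed
  have "gram_factor d S I r'"
    unfolding gram_factor_def rows_independent_def
  proof (intro conjI allI impI)
    show "finite I"
      using F by (simp add: gram_factor_def)
    show "dot I (r' i) (r' j) = S i j" if "i < d" "j < d" for i j
      using F that rt tt dot_commute[of I t "r j"]
      by (simp add: r'_def dot_linear gram_factor_def)
    fix c i assume c: "\<forall>n\<in>I. combine d r' c n = 0" and i: "i < d"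
    have "\<forall>n\<in>I. combine d r (\<lambda>i. c i + c k * a i) n = 0"
      using a c by (simp add: combine_r' combine_add combine_scale)
    then have *: "c i + c k * a i = 0" if "i < d" for i
      using F that unfolding gram_factor_def rows_independent_def by blast
    have "c k = 0"
      using *[OF k(1)] k(2) by simp
    then show "c i = 0"
      using *[OF i] by simp
  qed
  moreover have "\<forall>n\<in>I. column_sum d r' n = 1 + b n"
    by (simp add: column_sum_def combine_r') (simp add: t_def column_sum_def ac_simps)
  ultimately show ?thesis
    by blast
qed

lemma gram_factor_move_column_sum:
  assumes F: "gram_factor d S I r" and sum: "\<And>n. n \<in> I \<Longrightarrow> column_sum d r n = 1 + z n"
    and "dot I z z = 0" "dot I u u = 0" "dot I z u = 1"
  shows "\<exists>r'. gram_factor d S I r' \<and> (\<forall>n\<in>I. column_sum d r' n = 1 + u n)"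
proof -
  define v where "v = (\<lambda>n. z n + u n)"
  define r' where "r' = (\<lambda>i. transvection I v (r i))"
  have v: "dot I v v = 0" "transvection I v z = u"
    unfolding v_def by (rule transvection_moves; simp add: assms)+
  have "column_sum d r' n = 1 + u n" if "n \<in> I" for n
  proof -
    have "column_sum d r' n = transvection I v (column_sum d r) n"
      by (simp add: column_sum_def r'_def combine_transvection)
    also have "\<dots> = transvection I v (\<lambda>n. 1 + z n) n"
      using sum that by (intro transvection_cong)
    finally show ?thesis
      by (simp add: transvection_add transvection_one v)
  qed
  then show ?thesis
    using gram_factor_transvection[OF F v(1)] by (auto simp: r'_def)
qed

text \<open>
  Two nonconstant two-valued functions always have a common pair of points on which both change:
  if the pair for \<open>x\<close> fails for \<open>y\<close>, a third point on which \<open>y\<close> differs repairs it.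
\<close>
lemma exists_separating_pair:
  fixes x y :: "'n \<Rightarrow> bit"
  assumes "\<exists>p\<in>I. x p = 0" "\<exists>p\<in>I. x p = 1" "\<exists>p\<in>I. y p = 0" "\<exists>p\<in>I. y p = 1"
  shows "\<exists>p\<in>I. \<exists>q\<in>I. x p + x q = 1 \<and> y p + y q = 1"
proof -
  have ne: "s + t = 1 \<longleftrightarrow> s \<noteq> t" for s t :: bit
    by (cases s; cases t) simp_all
  obtain p q where pq: "p \<in> I" "q \<in> I" "x p \<noteq> x q"
    using assms by (metis bit_not_one_iff)
  show ?thesis
  proof (cases "y p = y q")
    case False
    then show ?thesis
      using pq by (auto simp: ne)
  next
    case True
    obtain s where "s \<in> I" "y s \<noteq> y p"
      using assms by (metis bit_not_one_iff)
    then show ?thesis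
      using pq True unfolding ne by (metis bit_not_one_iff)
  qed
qed

text \<open>
  Any nonconstant vector of even weight is carried to any other by two transvections, passing through
  a vector supported on a separating pair. This is the instance of Witt's extension theorem that is
  needed to reach an arbitrary prescription.
\<close>
lemma gram_factor_move_column_sum_pair:
  assumes F: "gram_factor d S I r" and sum: "\<And>n. n \<in> I \<Longrightarrow> column_sum d r n = 1 + z n"
    and "dot I z z = 0" "dot I b b = 0"
    and "\<exists>p\<in>I. z p = 0" "\<exists>p\<in>I. z p = 1" "\<exists>p\<in>I. b p = 0" "\<exists>p\<in>I. b p = 1"
  shows "\<exists>r'. gram_factor d S I r' \<and> (\<forall>n\<in>I. column_sum d r' n = 1 + b n)"
proof -
  have fin: "finite I"
    using F by (simp add: gram_factor_def)
  obtain p q where pq: "p \<in> I" "q \<in> I" "z p + z q = 1" "b p + b q = 1"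
    using exists_separating_pair[OF assms(5-8)] by blast
  define u where "u = (\<lambda>n. point p n + point q n)"
  have uI: "dot I x u = x p + x q" for x
    unfolding u_def dot_add_right by (simp add: dot_point fin pq)
  have "p \<noteq> q"
    using pq(3) by auto
  then have uu: "dot I u u = 0"
    unfolding uI by (simp add: u_def point_def)
  obtain r1 where r1: "gram_factor d S I r1" "\<forall>n\<in>I. column_sum d r1 n = 1 + u n"
    using gram_factor_move_column_sum[OF F sum assms(3) uu] pq(3) by (auto simp: uI)
  show ?thesis
    by (rule gram_factor_move_column_sum[OF r1(1) _ uu assms(4)])
       (use r1(2) pq(4) in \<open>simp_all add: dot_commute[of I u] uI\<close>)
qed

text \<open>
  Put \<open>b = 1 + a\<close>, which is even by the trace condition. If \<open>b = 0\<close>, it lies in the complement and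
  can be reached by changing one row. Otherwise \<open>b\<close> is nonconstant: first reach the nonconstant
  vector \<open>w\<close> of the complement, then move \<open>w\<close> to \<open>b\<close> by an isometry.
\<close>
lemma gram_factor_prescribed_column_sum:
  assumes F: "gram_factor d S I r" and sat: "saturated d I r"
    and parity: "\<And>i. i < d \<Longrightarrow> (\<Sum>j<d. S i j) = S i i"
    and w: "row_orthogonal d I r w" "\<exists>p\<in>I. w p = 0" "\<exists>p\<in>I. w p = 1"
    and a: "\<exists>p\<in>I. a p = 1" "(\<Sum>n\<in>I. a n) = (\<Sum>i<d. S i i)"
  shows "\<exists>r'. gram_factor d S I r' \<and> (\<forall>n\<in>I. column_sum d r' n = a n)"
proof -
  define b where "b = (\<lambda>n. 1 + a n)"
  have b0: "\<exists>p\<in>I. b p = 0"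
    using a(1) by (force simp: b_def)
  have ab: "a n = 1 + b n" for n
    by (simp add: b_def)
  show ?thesis
  proof (cases "\<exists>p\<in>I. b p = 1")
    case False
    then have "row_orthogonal d I r b"
      by (auto simp: row_orthogonal_def dot_def intro!: sum.neutral)
    then show ?thesis
      unfolding ab using gram_factor_column_sum_orthogonal[OF F sat parity, of b] b0 by blast
  next
    case True
    have "dot I b b = dot I (\<lambda>_. 1) (\<lambda>_. 1) + dot I a a"
      unfolding b_def dot_linear by (simp add: dot_one[of I a] dot_one_left[of I a] add.assoc)
    also have "dot I a a = (\<Sum>i<d. S i i)"
      using a(2) by (simp add: dot_def)
    finally have bb: "dot I b b = 0"
      by (simp add: dot_one_one_eq_trace[OF F sat parity])
    have ww: "dot I w w = 0"
      using w(1) sat by (intro dot_row_space_orthogonal) (auto simp: saturated_def)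
    obtain r' where r': "gram_factor d S I r'" "\<forall>n\<in>I. column_sum d r' n = 1 + w n"
      using gram_factor_column_sum_orthogonal[OF F sat parity w(1)] w(2) by blast
    show ?thesis
      unfolding ab
      by (rule gram_factor_move_column_sum_pair[OF r'(1) _ ww bb w(2,3) b0 True]) (simp add: r'(2))
  qed
qed

section \<open>Counting solutions over the field with two elements\<close>

abbreviation bspan :: "nat \<Rightarrow> bit vec set \<Rightarrow> bit vec set" where
  "bspan n \<equiv> LinearCombinations.module.span class_ring (module_vec TYPE(bit) n)"

abbreviation bindpt :: "nat \<Rightarrow> bit vec set \<Rightarrow> bool" where
  "bindpt n B \<equiv> \<not> LinearCombinations.module.lin_dep class_ring (module_vec TYPE(bit) n) B"

lemma UNIV_bit: "(UNIV :: bit set) = {0, 1}"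
  by auto

lemma finite_UNIV_bit [simp]: "finite (UNIV :: bit set)" and card_UNIV_bit [simp]: "card (UNIV :: bit set) = 2"
  by (simp_all add: UNIV_bit)

lemma vec_bit_add_self [simp]: "(x :: bit vec) \<in> carrier_vec n \<Longrightarrow> x + x = 0\<^sub>v n"
  by (auto intro!: eq_vecI)

lemma vec_bit_add_self_left [simp]:
  "(x :: bit vec) \<in> carrier_vec n \<Longrightarrow> y \<in> carrier_vec n \<Longrightarrow> x + (x + y) = y"
  by (auto intro!: eq_vecI)

lemma card_carrier_vec_bit: "card (carrier_vec n :: bit vec set) = 2 ^ n" "finite (carrier_vec n :: bit vec set)"
proof -
  have bij: "bij_betw (\<lambda>x :: bit vec. restrict (($) x) {..<n}) (carrier_vec n) ({..<n} \<rightarrow>\<^sub>E UNIV)"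
  proof (rule bij_betw_byWitness[where f' = "vec n"])
    show "\<forall>x\<in>carrier_vec n. vec n (restrict (($) x) {..<n}) = x"
      by (auto intro!: eq_vecI)
    show "\<forall>f\<in>{..<n} \<rightarrow>\<^sub>E UNIV. restrict (($) (vec n f)) {..<n} = f"
      by (auto simp: fun_eq_iff PiE_def extensional_def restrict_def)
    show "(\<lambda>x. restrict (($) x) {..<n}) ` carrier_vec n \<subseteq> {..<n} \<rightarrow>\<^sub>E UNIV"
      by (intro image_subsetI restrict_PiE_iff[THEN iffD2]) blast
    show "vec n ` ({..<n} \<rightarrow>\<^sub>E UNIV) \<subseteq> carrier_vec n"
      by (intro image_subsetI vec_carrier)
  qed
  show "card (carrier_vec n :: bit vec set) = 2 ^ n"
    using bij_betw_same_card[OF bij] by (simp add: card_funcsetE)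
  show "finite (carrier_vec n :: bit vec set)"
    using bij_betw_finite[OF bij] by (simp add: finite_PiE)
qed

lemma card_span_bit:
  assumes finB: "finite B" and B: "B \<subseteq> carrier_vec n" and ind: "bindpt n B"
  shows "card (bspan n B) = 2 ^ card B"
proof -
  interpret vec_space "TYPE(bit)" n .
  have "bij_betw (\<lambda>a. lincomb a B) (B \<rightarrow>\<^sub>E UNIV) (span B)"
    unfolding bij_betw_def
  proof
    show "inj_on (\<lambda>a. lincomb a B) (B \<rightarrow>\<^sub>E UNIV)"
    proof (rule inj_onI)
      fix a b :: "bit vec \<Rightarrow> bit"
      assume ab: "a \<in> B \<rightarrow>\<^sub>E UNIV" "b \<in> B \<rightarrow>\<^sub>E UNIV" and eq: "lincomb a B = lincomb b B"
      have "lincomb (\<lambda>v. a v + b v) B = lincomb a B + lincomb b B"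
        using lincomb_sum[OF finB, where a = a and b = b] B by simp
      also have "\<dots> = 0\<^sub>v n"
        unfolding eq using B by (simp add: lincomb_closed)
      finally have "(\<lambda>v. a v + b v) \<in> B \<rightarrow> {0}"
        using not_lindepD[OF ind finB] B by simp
      then have "a v = b v" if "v \<in> B" for v
        using that by (auto simp: bit_add_eq_0_iff)
      then show "a = b"
        using ab by (intro PiE_ext)
    qed
    show "(\<lambda>a. lincomb a B) ` (B \<rightarrow>\<^sub>E UNIV) = span B"
    proof
      show "(\<lambda>a. lincomb a B) ` (B \<rightarrow>\<^sub>E UNIV) \<subseteq> span B"
        using finB by auto
      show "span B \<subseteq> (\<lambda>a. lincomb a B) ` (B \<rightarrow>\<^sub>E UNIV)"
      proof
        fix v assume "v \<in> span B"
        then obtain a where a: "lincomb a B = v"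
          using finite_in_span[OF finB] B by auto
        have "lincomb (restrict a B) B = v"
          using a B by (subst a[symmetric], intro lincomb_cong) auto
        then show "v \<in> (\<lambda>a. lincomb a B) ` (B \<rightarrow>\<^sub>E UNIV)"
          by (intro image_eqI[of _ _ "restrict a B"]) auto
      qed
    qed
  qed
  from bij_betw_same_card[OF this] show ?thesis
    using finB by (simp add: card_funcsetE)
qed

lemma span_cols_eq_range:
  fixes A :: "bit mat"
  assumes "A \<in> carrier_mat n m"
  shows "bspan n (set (cols A)) = (\<lambda>x. A *\<^sub>v x) ` carrier_vec m"
proof -
  interpret vec_space "TYPE(bit)" n .
  show ?thesis
    using col_space_eq[OF assms] assms by (auto simp: col_space_def)
qed

text \<open>
  A maximal independent set of columns realizes the rank and spans the same space.
\<close>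
lemma column_basis_exists:
  fixes A :: "bit mat"
  assumes A: "A \<in> carrier_mat n m"
  obtains B where "B \<subseteq> set (cols A)" "bindpt n B" "card B = vec_space.rank n A"
    "bspan n B = bspan n (set (cols A))"
proof -
  interpret vec_space "TYPE(bit)" n .
  have cols: "set (cols A) \<subseteq> carrier_vec n"
    using A cols_dim by blast
  have "lin_indpt {}"
    by (simp add: lin_dep_def)
  then obtain B where max: "maximal B (\<lambda>T. T \<subseteq> set (cols A) \<and> lin_indpt T)"
    using maximal_exists_superset[of "set (cols A)" "\<lambda>T. T \<subseteq> set (cols A) \<and> lin_indpt T" "{}"] by auto
  then have B: "B \<subseteq> set (cols A)" "lin_indpt B"
    by (auto simp: maximal_def)
  have Bn: "B \<subseteq> carrier_vec n"
    using B cols by blast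
  have "set (cols A) \<subseteq> span B"
  proof
    fix v assume v: "v \<in> set (cols A)"
    show "v \<in> span B"
    proof (cases "v \<in> B")
      case True
      then show ?thesis
        using span_mem Bn by auto
    next
      case False
      have "lin_dep (B \<union> {v})"
      proof (rule ccontr)
        assume "lin_indpt (B \<union> {v})"
        then have "B \<union> {v} = B"
          using max B v unfolding maximal_def by blast
        then show False
          using False by blast
      qed
      then show ?thesis
        using lin_dep_iff_in_span[of B v] Bn B(2) v cols False by auto
    qed
  qed
  then have "span (set (cols A)) \<subseteq> span B"
    using span_subsetI[OF Bn] by blast
  moreover have "span B \<subseteq> span (set (cols A))"
    by (rule span_is_monotone[OF B(1)])
  ultimately show ?thesis
    using that[OF B] rank_card_indpt[OF A max] by auto
qed

lemma card_range_bit: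
  fixes A :: "bit mat"
  assumes A: "A \<in> carrier_mat n m"
  shows "card ((\<lambda>x. A *\<^sub>v x) ` carrier_vec m) = 2 ^ vec_space.rank n A"
proof -
  obtain B where B: "B \<subseteq> set (cols A)" "bindpt n B" "card B = vec_space.rank n A"
    "bspan n B = bspan n (set (cols A))"
    using column_basis_exists[OF A] .
  have "B \<subseteq> carrier_vec n"
    using B(1) A cols_dim by blast
  then show ?thesis
    using card_span_bit[OF finite_subset[OF B(1)] _ B(2)] B span_cols_eq_range[OF A] by simp
qed

text \<open>
  Rank-nullity in counting form: all nonempty fibres are translates of the kernel.
\<close>
lemma card_mat_kernel_bit:
  fixes A :: "bit mat"
  assumes A: "A \<in> carrier_mat n m"
  shows "card (mat_kernel A) * 2 ^ vec_space.rank n A = 2 ^ m"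
proof -
  let ?R = "(\<lambda>x. A *\<^sub>v x) ` carrier_vec m"
  define g where "g = (\<lambda>y. SOME x. x \<in> carrier_vec m \<and> A *\<^sub>v x = y)"
  have g: "g y \<in> carrier_vec m" "A *\<^sub>v g y = y" if "y \<in> ?R" for y
    using someI_ex[of "\<lambda>x. x \<in> carrier_vec m \<and> A *\<^sub>v x = y"] that unfolding g_def by blast+
  have ker: "x \<in> mat_kernel A \<longleftrightarrow> x \<in> carrier_vec m \<and> A *\<^sub>v x = 0\<^sub>v n" for x
    using A by (auto simp: mat_kernel_def)
  have "bij_betw (\<lambda>(x, y). g y + x) (mat_kernel A \<times> ?R) (carrier_vec m)"
  proof (rule bij_betw_byWitness[where f' = "\<lambda>x. (g (A *\<^sub>v x) + x, A *\<^sub>v x)"])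
    have add: "A *\<^sub>v (g y + x) = y" if "x \<in> mat_kernel A" "y \<in> ?R" for x y
      using that g[OF that(2)] A
      by (subst mult_add_distrib_mat_vec[OF A]) (auto simp: ker)
    show "\<forall>a\<in>mat_kernel A \<times> ?R. (\<lambda>x. (g (A *\<^sub>v x) + x, A *\<^sub>v x)) ((\<lambda>(x, y). g y + x) a) = a"
    proof
      fix a assume a: "a \<in> mat_kernel A \<times> ?R"
      obtain x y where xy: "a = (x, y)" by force
      show "(\<lambda>x. (g (A *\<^sub>v x) + x, A *\<^sub>v x)) ((\<lambda>(x, y). g y + x) a) = a"
        using a g(1)[of y] add[of x y] vec_bit_add_self_left[of "g y" m x]
        unfolding xy by (auto simp: ker)
    qed
    show "\<forall>x\<in>carrier_vec m. (\<lambda>(x, y). g y + x) ((\<lambda>x. (g (A *\<^sub>v x) + x, A *\<^sub>v x)) x) = x"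
    proof
      fix x :: "bit vec" assume "x \<in> carrier_vec m"
      then show "(\<lambda>(x, y). g y + x) ((\<lambda>x. (g (A *\<^sub>v x) + x, A *\<^sub>v x)) x) = x"
        using g(1)[of "A *\<^sub>v x"] by auto
    qed
    show "(\<lambda>(x, y). g y + x) ` (mat_kernel A \<times> ?R) \<subseteq> carrier_vec m"
      using g(1) by (auto simp: ker)
    show "(\<lambda>x. (g (A *\<^sub>v x) + x, A *\<^sub>v x)) ` carrier_vec m \<subseteq> mat_kernel A \<times> ?R"
    proof
      fix a assume "a \<in> (\<lambda>x. (g (A *\<^sub>v x) + x, A *\<^sub>v x)) ` carrier_vec m"
      then obtain x where x: "x \<in> carrier_vec m" "a = (g (A *\<^sub>v x) + x, A *\<^sub>v x)"
        by blast
      have "A *\<^sub>v (g (A *\<^sub>v x) + x) = A *\<^sub>v x + A *\<^sub>v x"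
        using g[of "A *\<^sub>v x"] x(1) by (subst mult_add_distrib_mat_vec[OF A]) auto
      also have "\<dots> = 0\<^sub>v n"
        using A x(1) by (intro vec_bit_add_self) auto
      finally show "a \<in> mat_kernel A \<times> ?R"
        using x g(1)[of "A *\<^sub>v x"] by (auto simp: ker)
    qed
  qed
  from bij_betw_same_card[OF this] show ?thesis
    by (simp add: card_cartesian_product card_carrier_vec_bit card_range_bit[OF A])
qed

lemma mat_kernel_bit_iff:
  fixes A :: "bit mat"
  assumes "A \<in> carrier_mat n m"
  shows "x \<in> mat_kernel A \<longleftrightarrow> x \<in> carrier_vec m \<and> (\<forall>i<n. (\<Sum>j<m. A $$ (i, j) * x $ j) = 0)"
proof -
  have "A *\<^sub>v x = 0\<^sub>v n \<longleftrightarrow> (\<forall>i<n. (\<Sum>j<m. A $$ (i, j) * x $ j) = 0)" if x: "x \<in> carrier_vec m"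
  proof -
    have "(A *\<^sub>v x) $ i = (\<Sum>j<m. A $$ (i, j) * x $ j)" if "i < n" for i
      using assms x that by (simp add: scalar_prod_def atLeast0LessThan)
    then show ?thesis
      using assms by (simp add: vec_eq_iff)
  qed
  then show ?thesis
    using mat_kernel[OF assms] by blast
qed

lemma rank_bit_le_rows:
  fixes A :: "bit mat"
  assumes A: "A \<in> carrier_mat n m"
  shows "vec_space.rank n A \<le> n"
proof -
  have "card ((\<lambda>x. A *\<^sub>v x) ` carrier_vec m) \<le> card (carrier_vec n :: bit vec set)"
    using A by (intro card_mono card_carrier_vec_bit) auto
  then show ?thesis
    by (simp add: card_range_bit[OF A] card_carrier_vec_bit)
qed

text \<open>
  Independent rows force the columns to span. With fewer than \<open>n\<close> basis columns, the linear forms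
  \<open>x \<mapsto> (b, x)\<close> for basis columns \<open>b\<close> would have a common nonzero zero by counting, and that zero
  would be orthogonal to every column.
\<close>
lemma trivial_left_kernel_imp_full_rank:
  fixes A :: "bit mat"
  assumes A: "A \<in> carrier_mat n m"
    and triv: "\<And>x. x \<in> carrier_vec n \<Longrightarrow> (\<And>v. v \<in> set (cols A) \<Longrightarrow> x \<bullet> v = 0) \<Longrightarrow> x = 0\<^sub>v n"
  shows "vec_space.rank n A = n" "bspan n (set (cols A)) = carrier_vec n"
proof -
  interpret vec_space "TYPE(bit)" n .
  obtain B where B: "B \<subseteq> set (cols A)" "lin_indpt B" "card B = rank A" "span B = span (set (cols A))"
    using column_basis_exists[OF A] .
  have cols: "set (cols A) \<subseteq> carrier_vec n"
    using A cols_dim by blast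
  then have Bn: "B \<subseteq> carrier_vec n"
    using B(1) by blast
  obtain bs where bs: "set bs = B" "length bs = card B"
    using finite_distinct_list[of B] distinct_card finite_subset[OF B(1)] by force
  define M where "M = mat_of_rows n bs"
  have M: "M \<in> carrier_mat (card B) n"
    unfolding M_def bs(2)[symmetric] by (rule mat_of_rows_carrier)
  have "mat_kernel M \<subseteq> {0\<^sub>v n}"
  proof
    fix x assume "x \<in> mat_kernel M"
    then have x: "x \<in> carrier_vec n" "M *\<^sub>v x = 0\<^sub>v (card B)"
      using M by (auto simp: mat_kernel_def)
    have "x \<bullet> b = 0" if "b \<in> B" for b
    proof -
      have "b \<in> set bs"
        using that bs(1) by simp
      then obtain i where i: "i < card B" "bs ! i = b"
        unfolding in_set_conv_nth bs(2) by blast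
      have "b \<in> carrier_vec n"
        using Bn that by (rule subsetD)
      have "row M i = b"
        unfolding M_def i(2)[symmetric]
        by (rule mat_of_rows_row) (use i bs(2) \<open>b \<in> carrier_vec n\<close> in auto)
      then have "b \<bullet> x = (M *\<^sub>v x) $ i"
        using i(1) M by simp
      then show ?thesis
        using i x \<open>b \<in> carrier_vec n\<close> by (simp add: comm_scalar_prod[of x n b])
    qed
    then have "x \<in> orthogonal_complement B"
      using x by (simp add: orthogonal_complement_def)
    then have "x \<in> orthogonal_complement (span (set (cols A)))"
      using in_orthogonal_complement_span[OF Bn] B(4) by simp
    then have "x \<in> orthogonal_complement (set (cols A))"
      using in_orthogonal_complement_span[OF cols] by simp
    then show "x \<in> {0\<^sub>v n}"
      using triv x(1) by (auto simp: orthogonal_complement_def)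
  qed
  then have "card (mat_kernel M) \<le> 1"
    using card_mono[of "{0\<^sub>v n}" "mat_kernel M"] by simp
  then have "(2::nat) ^ n \<le> 2 ^ vec_space.rank (card B) M"
    using card_mat_kernel_bit[OF M] by (metis mult_1 mult_le_mono1)
  also have "\<dots> \<le> 2 ^ rank A"
    using rank_bit_le_rows[OF M] B(3) by simp
  finally show r: "rank A = n"
    using rank_bit_le_rows[OF A] by simp
  show "span (set (cols A)) = carrier_vec n"
    unfolding span_cols_eq_range[OF A]
    using A by (intro card_subset_eq card_carrier_vec_bit) (auto simp: card_range_bit card_carrier_vec_bit r)
qed

section \<open>Frames as Gram factorizations\<close>

abbreviation entries :: "bit mat \<Rightarrow> nat \<Rightarrow> nat \<Rightarrow> bit" where
  "entries S \<equiv> \<lambda>i j. S $$ (i, j)"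

definition frame_rows :: "bit vec list \<Rightarrow> nat \<Rightarrow> nat \<Rightarrow> bit" where
  "frame_rows fs = (\<lambda>i n. fs ! n $ i)"

lemma combine_frame_rows:
  assumes "set fs \<subseteq> carrier_vec d" "n < length fs"
  shows "combine d (frame_rows fs) c n = vec d c \<bullet> fs ! n"
proof -
  have "fs ! n \<in> carrier_vec d"
    using assms nth_mem by blast
  then show ?thesis
    by (simp add: combine_def frame_rows_def scalar_prod_def atLeast0LessThan)
qed

lemma independent_imp_separating:
  assumes fs: "set fs \<subseteq> carrier_vec d" and ind: "rows_independent d {..<length fs} (frame_rows fs)"
    and x: "x \<in> carrier_vec d" "\<And>f. f \<in> set fs \<Longrightarrow> x \<bullet> f = 0"
  shows "x = 0\<^sub>v d"
proof -
  have "vec d (($) x) = x"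
    using x(1) by (auto intro!: eq_vecI)
  then have "\<forall>n\<in>{..<length fs}. combine d (frame_rows fs) (($) x) n = 0"
    using x(2) by (simp add: combine_frame_rows[OF fs])
  then have "\<forall>i<d. x $ i = 0"
    using ind unfolding rows_independent_def by blast
  then show ?thesis
    using x(1) by (intro eq_vecI) auto
qed

lemma binary_frame_iff_independent:
  assumes fs: "set fs \<subseteq> carrier_vec d"
  shows "binary_frame d fs \<longleftrightarrow> rows_independent d {..<length fs} (frame_rows fs)"
proof
  interpret vec_space "TYPE(bit)" d .
  assume "binary_frame d fs"
  then have span: "span (set fs) = carrier_vec d"
    by (simp add: binary_frame_def)
  show "rows_independent d {..<length fs} (frame_rows fs)"
    unfolding rows_independent_def
  proof (intro allI impI)
    fix c i assume c: "\<forall>n\<in>{..<length fs}. combine d (frame_rows fs) c n = 0" and i: "i < d"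
    have "vec d c \<in> orthogonal_complement (set fs)"
      using c by (auto simp: orthogonal_complement_def in_set_conv_nth combine_frame_rows[OF fs])
    then have "vec d c \<in> orthogonal_complement (carrier_vec d)"
      using in_orthogonal_complement_span[OF fs] span by simp
    then have "vec d c \<bullet> unit_vec d i = 0"
      by (simp add: orthogonal_complement_def)
    then show "c i = 0"
      using i by simp
  qed
next
  assume ind: "rows_independent d {..<length fs} (frame_rows fs)"
  have "bspan d (set (cols (mat_of_cols d fs))) = carrier_vec d"
    by (rule trivial_left_kernel_imp_full_rank(2)[OF mat_of_cols_carrier(1)])
       (use fs independent_imp_separating[OF fs ind] in \<open>simp add: cols_mat_of_cols\<close>)
  then show "binary_frame d fs"
    using fs by (simp add: binary_frame_def cols_mat_of_cols)
qed

lemma frame_operator_carrier: "frame_operator d fs \<in> carrier_mat d d"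
  unfolding frame_operator_def synthesis_operator_def
  by (rule mult_carrier_mat[where n = "length fs"]) simp_all

lemma frame_operator_index:
  assumes "i < d" "j < d"
  shows "frame_operator d fs $$ (i, j) = dot {..<length fs} (frame_rows fs i) (frame_rows fs j)"
  using assms
  by (simp add: frame_operator_def synthesis_operator_def scalar_prod_def dot_def frame_rows_def
      mat_of_cols_def atLeast0LessThan)

lemma frame_iff_gram_factor:
  assumes fs: "set fs \<subseteq> carrier_vec d" and S: "S \<in> carrier_mat d d"
  shows "binary_frame d fs \<and> frame_operator d fs = S \<longleftrightarrow>
    gram_factor d (entries S) {..<length fs} (frame_rows fs)"
proof -
  have "frame_operator d fs = S \<longleftrightarrow>
    (\<forall>i<d. \<forall>j<d. dot {..<length fs} (frame_rows fs i) (frame_rows fs j) = S $$ (i, j))"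
  proof
    assume *: "\<forall>i<d. \<forall>j<d. dot {..<length fs} (frame_rows fs i) (frame_rows fs j) = S $$ (i, j)"
    show "frame_operator d fs = S"
      using S frame_operator_carrier[of d fs] *
      by (intro eq_matI) (simp_all add: frame_operator_index)
  next
    assume eq: "frame_operator d fs = S"
    show "\<forall>i<d. \<forall>j<d. dot {..<length fs} (frame_rows fs i) (frame_rows fs j) = S $$ (i, j)"
      using frame_operator_index[of _ d _ fs] unfolding eq by simp
  qed
  then show ?thesis
    by (auto simp: gram_factor_def binary_frame_iff_independent[OF fs])
qed

lemma dot_frame_vector:
  assumes "set fs \<subseteq> carrier_vec d" "n < length fs"
  shows "fs ! n \<bullet> fs ! n = column_sum d (frame_rows fs) n"
proof -
  have "fs ! n \<in> carrier_vec d"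
    using assms nth_mem by blast
  then show ?thesis
    by (simp add: column_sum_def combine_def frame_rows_def scalar_prod_def atLeast0LessThan)
qed

lemma frame_of_gram_factor:
  assumes S: "S \<in> carrier_mat d d" and F: "gram_factor d (entries S) {..<N} r"
  shows "\<exists>fs. binary_frame d fs \<and> length fs = N \<and> frame_operator d fs = S \<and>
    (\<forall>n<N. fs ! n \<bullet> fs ! n = column_sum d r n)"
proof -
  define fs where "fs = map (\<lambda>n. vec d (\<lambda>i. r i n)) [0..<N]"
  have fs: "set fs \<subseteq> carrier_vec d" "length fs = N"
    by (auto simp: fs_def)
  have rows: "frame_rows fs i n = r i n" if "i < d" "n < N" for i n
    using that by (simp add: fs_def frame_rows_def)
  have comb: "combine d (frame_rows fs) c n = combine d r c n" if "n < N" for c n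
    using that by (simp add: combine_def rows)
  have "dot {..<N} (frame_rows fs i) (frame_rows fs j) = dot {..<N} (r i) (r j)" if "i < d" "j < d" for i j
    using that by (intro dot_cong) (auto simp: rows)
  then have "gram_factor d (entries S) {..<length fs} (frame_rows fs)"
    using F by (simp add: gram_factor_def rows_independent_def comb fs(2))
  then have "binary_frame d fs \<and> frame_operator d fs = S"
    using frame_iff_gram_factor[OF fs(1) S] by blast
  moreover have "fs ! n \<bullet> fs ! n = column_sum d r n" if "n < N" for n
    using dot_frame_vector[OF fs(1)] fs(2) that by (simp add: column_sum_def comb)
  ultimately show ?thesis
    using fs(2) by blast
qed

section \<open>The length of a frame\<close>

text \<open>
  The complement of the row space has dimension \<open>N - d\<close>.
\<close>
lemma card_orthogonal_vecs:
  assumes F: "gram_factor d S {..<N} r"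
  shows "card {z \<in> carrier_vec N. row_orthogonal d {..<N} r (($) z)} * 2 ^ d = 2 ^ N"
proof -
  define A where "A = mat d N (\<lambda>(i, n). r i n)"
  have A: "A \<in> carrier_mat d N"
    by (simp add: A_def)
  have triv: "x = 0\<^sub>v d" if x: "x \<in> carrier_vec d" "\<And>v. v \<in> set (cols A) \<Longrightarrow> x \<bullet> v = 0" for x
  proof -
    have "combine d r (($) x) n = 0" if n: "n < N" for n
    proof -
      have "x \<bullet> col A n = 0"
        using x(2) n A by (simp add: cols_def)
      then show ?thesis
        using n A by (simp add: scalar_prod_def A_def combine_def atLeast0LessThan)
    qed
    then have "\<forall>i<d. x $ i = 0"
      using F unfolding gram_factor_def rows_independent_def by blast
    then show ?thesis
      using x(1) by (intro eq_vecI) auto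
  qed
  have "vec_space.rank d A = d"
    by (rule trivial_left_kernel_imp_full_rank(1)[OF A triv])
  moreover have "mat_kernel A = {z \<in> carrier_vec N. row_orthogonal d {..<N} r (($) z)}"
    unfolding set_eq_iff mat_kernel_bit_iff[OF A]
    by (simp add: row_orthogonal_def dot_def A_def)
  ultimately show ?thesis
    using card_mat_kernel_bit[OF A] by simp
qed

text \<open>
  The map \<open>x \<mapsto> \<Theta>\<^sup>* x\<close> embeds the kernel of \<open>S\<close>, of dimension \<open>d - rank S\<close>, into the complement
  of the row space, of dimension \<open>N - d\<close>. Saturation is precisely surjectivity of this embedding.
\<close>
lemma gram_factor_length:
  assumes S: "S \<in> carrier_mat d d" and F: "gram_factor d (entries S) {..<N} r"
  shows "2 * d - vec_space.rank d S \<le> N"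
    and "saturated d {..<N} r \<Longrightarrow> N = 2 * d - vec_space.rank d S"
proof -
  let ?rk = "vec_space.rank d S"
  let ?O = "{z \<in> carrier_vec N. row_orthogonal d {..<N} r (($) z)}"
  let ?f = "\<lambda>x. vec N (combine d r (($) x))"
  have orth_vec: "row_orthogonal d {..<N} r (($) (vec N z)) \<longleftrightarrow> row_orthogonal d {..<N} r z" for z
    unfolding row_orthogonal_def by (simp add: dot_def)
  have ker: "x \<in> mat_kernel S \<longleftrightarrow> x \<in> carrier_vec d \<and> row_orthogonal d {..<N} r (combine d r (($) x))" for x
    unfolding mat_kernel_bit_iff[OF S] orthogonal_combine_iff[OF F] by simp
  have finO: "finite ?O"
    using card_carrier_vec_bit(2)[of N] by (rule finite_subset[rotated]) auto
  have f_into: "?f ` mat_kernel S \<subseteq> ?O"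
    by (auto simp: ker orth_vec)
  have inj: "inj_on ?f (mat_kernel S)"
  proof (rule inj_onI)
    fix x y assume xy: "x \<in> mat_kernel S" "y \<in> mat_kernel S" and eq: "?f x = ?f y"
    have "combine d r (($) x) n = combine d r (($) y) n" if "n < N" for n
      using arg_cong[OF eq, of "\<lambda>v. v $ n"] that by simp
    then have "\<forall>n\<in>{..<N}. combine d r (\<lambda>i. x $ i + y $ i) n = 0"
      by (simp add: combine_add)
    then have "\<forall>i<d. x $ i + y $ i = 0"
      using F unfolding gram_factor_def rows_independent_def by blast
    then show "x = y"
      using xy by (intro eq_vecI) (auto simp: ker bit_add_eq_0_iff)
  qed
  have le_d: "?rk \<le> d"
    by (rule rank_bit_le_rows[OF S])
  have card_ker: "card (mat_kernel S) * 2 ^ ?rk = 2 ^ d"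
    by (rule card_mat_kernel_bit[OF S])
  have card_O: "card ?O * 2 ^ d = 2 ^ N"
    by (rule card_orthogonal_vecs[OF F])
  have "card (mat_kernel S) \<le> card ?O"
    by (rule card_inj_on_le[OF inj f_into finO])
  (* scaled so that both sides become powers of two by the two counting formulas *)
  then have "(card (mat_kernel S) * 2 ^ ?rk) * 2 ^ d \<le> (card ?O * 2 ^ d) * 2 ^ ?rk"
    by simp
  then have "(2::nat) ^ (d + d) \<le> 2 ^ (N + ?rk)"
    unfolding card_ker card_O by (simp add: power_add)
  then show "2 * d - ?rk \<le> N"
    by simp
  assume sat: "saturated d {..<N} r"
  have "?O \<subseteq> ?f ` mat_kernel S"
  proof
    fix z assume z: "z \<in> ?O"
    then obtain c where c: "\<forall>n\<in>{..<N}. z $ n = combine d r c n"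
      using sat by (auto simp: saturated_def in_row_space_def)
    define x where "x = vec d c"
    have "combine d r (($) x) = combine d r c"
      by (simp add: combine_def x_def)
    then have zx: "z = ?f x"
      using z c by (intro eq_vecI) auto
    have "row_orthogonal d {..<N} r (($) (?f x))"
      using z unfolding zx[symmetric] by blast
    then have "x \<in> mat_kernel S"
      unfolding ker orth_vec by (simp add: x_def)
    then show "z \<in> ?f ` mat_kernel S"
      using zx by blast
  qed
  then have "card (mat_kernel S) = card ?O"
    using f_into card_image[OF inj] by (simp add: subset_antisym)
  then have "(card (mat_kernel S) * 2 ^ ?rk) * 2 ^ d = (card ?O * 2 ^ d) * 2 ^ ?rk"
    by simp
  then have "(2::nat) ^ (d + d) = 2 ^ (N + ?rk)"
    unfolding card_ker card_O by (simp add: power_add)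
  then show "N = 2 * d - ?rk"
    by simp
qed

lemma minimal_frame_of_length:
  assumes S: "S \<in> carrier_mat d d" and fs: "binary_frame d fs" "frame_operator d fs = S"
    "length fs = 2 * d - vec_space.rank d S"
  shows "minimal_frame d fs"
  unfolding minimal_frame_def
proof (intro conjI allI impI fs(1))
  fix gs assume "binary_frame d gs \<and> frame_operator d gs = frame_operator d fs"
  then have "gram_factor d (entries S) {..<length gs} (frame_rows gs)"
    using frame_iff_gram_factor[OF _ S, of gs] fs(2) by (simp add: binary_frame_def)
  then show "length fs \<le> length gs"
    using gram_factor_length(1)[OF S] fs(3) by simp
qed

section \<open>Norms of the elements of a minimal frame\<close>

lemma parity_indicative_row_sum:
  assumes S: "S \<in> carrier_mat d d" and "parity_indicative S" and i: "i < d"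
  shows "(\<Sum>j<d. S $$ (i, j)) = S $$ (i, i)"
proof -
  have "row S i \<bullet> row S i = (\<Sum>j<d. S $$ (i, j))"
    using S i by (simp add: scalar_prod_def atLeast0LessThan)
  moreover have "S $$ (i, i) = 1 \<longleftrightarrow> row S i \<bullet> row S i \<noteq> 0"
    using assms by (simp add: parity_indicative_def even_vec_def)
  ultimately show ?thesis
    by (cases "S $$ (i, i)") auto
qed

lemma norm0_eq_sum: "of_nat (norm0 v) = (\<Sum>n<dim_vec v. v $ n)"
proof -
  have "(\<Sum>n<dim_vec v. v $ n) = (\<Sum>n<dim_vec v. of_bool (v $ n \<noteq> 0))"
    by (intro sum.cong) auto
  also have "\<dots> = of_nat (card ({..<dim_vec v} \<inter> {n. v $ n \<noteq> 0}))"
    using sum_of_bool_eq[OF finite_lessThan, of "dim_vec v" "\<lambda>n. v $ n \<noteq> 0"] by blast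
  also have "{..<dim_vec v} \<inter> {n. v $ n \<noteq> 0} = {i. i < dim_vec v \<and> v $ i \<noteq> 0}"
    by auto
  finally show ?thesis
    by (simp add: norm0_def)
qed

lemma norm0_eq_dim:
  assumes "\<And>n. n < dim_vec v \<Longrightarrow> v $ n = 1"
  shows "norm0 v = dim_vec v"
proof -
  have "{i. i < dim_vec v \<and> v $ i \<noteq> 0} = {..<dim_vec v}"
    using assms by auto
  then show ?thesis
    by (simp add: norm0_def)
qed

text \<open>
  It remains to produce a nonconstant vector in the complement of the row space. Images of distinct
  kernel vectors of \<open>S\<close> are distinct, so at most one nonzero kernel vector has the all-one vector as
  image. If the diagonal of \<open>S\<close> is nonzero, the all-one vector is not in the complement at all and one
  nonzero kernel vector suffices; otherwise the kernel has at least two nonzero vectors.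
\<close>
lemma minimal_frame_with_norms:
  assumes S: "S \<in> carrier_mat d d" and sym: "transpose_mat S = S" and par: "parity_indicative S"
    and K: "K = 2 * d - vec_space.rank d S"
    and \<alpha>: "\<alpha> \<in> carrier_vec K" "\<alpha> \<noteq> 0\<^sub>v K" "of_nat (norm0 \<alpha>) = trace_mat S"
    and large: "vec_space.rank d S < d" "diag_vec S \<noteq> 0\<^sub>v d \<or> vec_space.rank d S < d - 1"
  shows "\<exists>fs. binary_frame d fs \<and> length fs = K \<and> minimal_frame d fs \<and> S = frame_operator d fs
    \<and> (\<forall>i<K. fs ! i \<bullet> fs ! i = \<alpha> $ i)"
proof -
  let ?rk = "vec_space.rank d S"
  have symS: "S $$ (i, j) = S $$ (j, i)" if "i < d" "j < d" for i j
    using that S arg_cong[OF sym, of "\<lambda>M. M $$ (i, j)"] by simp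
  have parS: "(\<Sum>j<d. S $$ (i, j)) = S $$ (i, i)" if "i < d" for i
    by (rule parity_indicative_row_sum[OF S par that])
  have finker: "finite (mat_kernel S)"
    using card_carrier_vec_bit(2)[of d]
    by (rule finite_subset[rotated]) (use S in \<open>auto simp: mat_kernel_def\<close>)
  have "card (mat_kernel S) * 2 ^ ?rk = 2 ^ (d - ?rk) * 2 ^ ?rk"
    using card_mat_kernel_bit[OF S] large(1) by (simp flip: power_add)
  then have card_ker: "card (mat_kernel S) = 2 ^ (d - ?rk)"
    by simp
  have "2 ^ 1 \<le> card (mat_kernel S)"
    unfolding card_ker using large(1) by (intro power_increasing) auto
  then have "\<not> mat_kernel S \<subseteq> {0\<^sub>v d}"
    using card_mono[of "{0\<^sub>v d}" "mat_kernel S"] by auto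
  then obtain x where x: "x \<in> mat_kernel S" "x \<noteq> 0\<^sub>v d"
    by auto
  have nonzero: "\<exists>i<d. y $ i \<noteq> 0" if "y \<in> mat_kernel S" "y \<noteq> 0\<^sub>v d" for y
  proof (rule ccontr)
    assume "\<not> (\<exists>i<d. y $ i \<noteq> 0)"
    then have "y = 0\<^sub>v d"
      using that(1) S by (intro eq_vecI) (auto simp: mat_kernel_bit_iff)
    then show False
      using that(2) by simp
  qed
  obtain k where k: "k < d" "x $ k \<noteq> 0"
    using nonzero[OF x] by blast
  obtain I :: "(nat \<times> nat) set" and r0 where "gram_factor d (entries S) I r0"
    using gram_factor_exists[of d "entries S"] symS by blast
  then obtain J :: "(nat \<times> nat) set" and r1 where "gram_factor d (entries S) J r1" "saturated d J r1"
    using saturated_gram_factor_subset[of d "entries S" I r0 "($) x" k] k x(1)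
    by (auto simp: mat_kernel_bit_iff[OF S])
  then obtain r where F: "gram_factor d (entries S) {..<card J} r" and sat: "saturated d {..<card J} r"
    using gram_factor_reindex by blast
  have J: "card J = K"
    using gram_factor_length(2)[OF S F sat] K by simp
  note F = F[unfolded J] and sat = sat[unfolded J]
  have orth: "row_orthogonal d {..<K} r (combine d r (($) y))" if "y \<in> mat_kernel S" for y
    using that unfolding orthogonal_combine_iff[OF F] by (simp add: mat_kernel_bit_iff[OF S])
  have hit1: "\<exists>p\<in>{..<K}. combine d r c p = 1" if "i < d" "c i \<noteq> 0" for c i
  proof (rule ccontr)
    assume "\<not> (\<exists>p\<in>{..<K}. combine d r c p = 1)"
    then have "\<forall>n\<in>{..<K}. combine d r c n = 0"
      by simp
    then show False
      using F that unfolding gram_factor_def rows_independent_def by blast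
  qed
  have "\<exists>y\<in>mat_kernel S. y \<noteq> 0\<^sub>v d \<and> (\<exists>p\<in>{..<K}. combine d r (($) y) p = 0)"
  proof (cases "diag_vec S = 0\<^sub>v d")
    case False
    then obtain i where i: "i < d" "S $$ (i, i) \<noteq> 0"
      using S by (auto simp: diag_vec_def vec_eq_iff)
    have "\<exists>p\<in>{..<K}. combine d r (($) x) p = 0"
    proof (rule ccontr)
      assume "\<not> (\<exists>p\<in>{..<K}. combine d r (($) x) p = 0)"
      (* a constant image would make the nonzero diagonal entry (r i, 1) vanish *)
      then have "dot {..<K} (r i) (combine d r (($) x)) = dot {..<K} (r i) (r i)"
        by (subst dot_one[symmetric], intro dot_cong) auto
      then show False
        using orth[OF x(1)] F i by (simp add: row_orthogonal_def gram_factor_def)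
    qed
    then show ?thesis
      using x by blast
  next
    case True
    then have "?rk < d - 1"
      using large(2) by simp
    then have "2 ^ 2 \<le> card (mat_kernel S)"
      unfolding card_ker by (intro power_increasing) auto
    then have "\<not> mat_kernel S \<subseteq> {0\<^sub>v d, x}"
      using card_mono[of "{0\<^sub>v d, x}" "mat_kernel S"] card_insert_le_m1[of 2 "{x}" "0\<^sub>v d"] by auto
    then obtain y where y: "y \<in> mat_kernel S" "y \<noteq> 0\<^sub>v d" "y \<noteq> x"
      by auto
    have "\<exists>i<d. x $ i + y $ i \<noteq> 0"
    proof (rule ccontr)
      assume "\<not> (\<exists>i<d. x $ i + y $ i \<noteq> 0)"
      then have "y = x"
        using x y S by (intro eq_vecI) (auto simp: mat_kernel_bit_iff bit_add_eq_0_iff)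
      then show False
        using y(3) by simp
    qed
    then obtain i where "i < d" "x $ i + y $ i \<noteq> 0"
      by blast
    then obtain p where p: "p < K" "combine d r (\<lambda>i. x $ i + y $ i) p = 1"
      using hit1[of i "\<lambda>i. x $ i + y $ i"] by auto
    then have "combine d r (($) x) p = 0 \<or> combine d r (($) y) p = 0"
      by (cases "combine d r (($) x) p"; cases "combine d r (($) y) p") (auto simp: combine_add)
    then show ?thesis
      using x y p(1) by blast
  qed
  then obtain y where y: "y \<in> mat_kernel S" "y \<noteq> 0\<^sub>v d" "\<exists>p\<in>{..<K}. combine d r (($) y) p = 0"
    by blast
  have "\<exists>p\<in>{..<K}. \<alpha> $ p = 1"
  proof (rule ccontr)
    assume "\<not> (\<exists>p\<in>{..<K}. \<alpha> $ p = 1)"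
    then have "\<alpha> = 0\<^sub>v K"
      using \<alpha>(1) by (intro eq_vecI) auto
    then show False
      using \<alpha>(2) by simp
  qed
  moreover have "(\<Sum>n\<in>{..<K}. \<alpha> $ n) = (\<Sum>i<d. S $$ (i, i))"
    using \<alpha>(1,3) norm0_eq_sum[of \<alpha>] S by (simp add: trace_mat_def)
  ultimately obtain r' where r': "gram_factor d (entries S) {..<K} r'"
    "\<forall>n\<in>{..<K}. column_sum d r' n = \<alpha> $ n"
    using gram_factor_prescribed_column_sum[OF F sat _ orth[OF y(1)] y(3), of "($) \<alpha>"] parS
      hit1 nonzero[OF y(1,2)] by blast
  obtain fs where "binary_frame d fs" "length fs = K" "frame_operator d fs = S"
    "\<forall>n<K. fs ! n \<bullet> fs ! n = column_sum d r' n"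
    using frame_of_gram_factor[OF S r'(1)] by blast
  then show ?thesis
    using minimal_frame_of_length[OF S, of fs] r'(2) K by (intro exI[of _ fs]) auto
qed

text \<open>
  The vector \<open>\<beta> = 1 + \<alpha>\<close> lies in the complement of the row space, which consists of \<open>0\<close> alone if
  \<open>K = d\<close>, and of \<open>0\<close> and the all-one vector if \<open>K = d + 1\<close> and the diagonal vanishes. As
  \<open>\<alpha> \<noteq> 0\<close>, in both cases \<open>\<beta> = 0\<close>.
\<close>
lemma frame_norms_all_one:
  assumes S: "S \<in> carrier_mat d d" and par: "parity_indicative S"
    and \<alpha>: "\<alpha> \<in> carrier_vec K" "\<alpha> \<noteq> 0\<^sub>v K"
    and fs: "binary_frame d fs" "length fs = K" "S = frame_operator d fs"
    "\<forall>i<K. fs ! i \<bullet> fs ! i = \<alpha> $ i"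
    and tight: "K = d \<or> K = d + 1 \<and> diag_vec S = 0\<^sub>v d"
  shows "norm0 \<alpha> = K"
proof -
  let ?r = "frame_rows fs"
  let ?O = "{z \<in> carrier_vec K. row_orthogonal d {..<K} ?r (($) z)}"
  have fsc: "set fs \<subseteq> carrier_vec d"
    using fs(1) by (simp add: binary_frame_def)
  have F: "gram_factor d (entries S) {..<K} ?r"
    using frame_iff_gram_factor[OF fsc S] fs(1-3) by auto
  have orth_vec: "row_orthogonal d {..<K} ?r (($) (vec K z)) \<longleftrightarrow> row_orthogonal d {..<K} ?r z" for z
    unfolding row_orthogonal_def by (simp add: dot_def)
  define \<beta> where "\<beta> = vec K (\<lambda>n. 1 + column_sum d ?r n)"
  have \<alpha>\<beta>: "\<alpha> $ n = 1 + \<beta> $ n" if "n < K" for n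
    using fs(2,4) that dot_frame_vector[OF fsc, of n] by (simp add: \<beta>_def)
  have "row_orthogonal d {..<K} ?r (\<lambda>n. 1 + column_sum d ?r n)"
    by (rule column_sum_plus_one_orthogonal[OF F]) (rule parity_indicative_row_sum[OF S par])
  then have \<beta>O: "\<beta> \<in> ?O"
    unfolding \<beta>_def using orth_vec by simp
  have zeroO: "0\<^sub>v K \<in> ?O"
    by (simp add: row_orthogonal_def dot_def)
  have finO: "finite ?O"
    using card_carrier_vec_bit(2)[of K] by (rule finite_subset[rotated]) auto
  have card_O: "card ?O * 2 ^ d = 2 ^ K"
    by (rule card_orthogonal_vecs[OF F])
  have "\<beta> = 0\<^sub>v K"
    using tight
  proof
    assume "K = d"
    then have "card ?O \<le> 1"
      using card_O by simp
    then show ?thesis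
      using \<beta>O zeroO finO by (simp only: card_le_Suc0_iff_eq One_nat_def)
  next
    assume K: "K = d + 1 \<and> diag_vec S = 0\<^sub>v d"
    define j where "j = vec K (\<lambda>_. 1 :: bit)"
    have "dot {..<K} (?r i) (\<lambda>_. 1) = 0" if "i < d" for i
    proof -
      have "diag_vec S $ i = S $$ (i, i)"
        using S that by (simp add: diag_vec_def)
      then show ?thesis
        using F K that by (simp add: dot_one gram_factor_def)
    qed
    then have jO: "j \<in> ?O"
      unfolding j_def using orth_vec[of "\<lambda>_. 1"] by (simp add: row_orthogonal_def)
    have j: "j \<noteq> 0\<^sub>v K"
      using K by (auto simp: j_def vec_eq_iff)
    have "card ?O = 2"
      using card_O K by simp
    then have "?O = {0\<^sub>v K, j}"
      using zeroO jO j finO by (intro card_seteq[symmetric]) auto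
    moreover have "\<beta> \<noteq> j"
    proof
      assume "\<beta> = j"
      then have "\<alpha> = 0\<^sub>v K"
        using \<alpha>(1) \<alpha>\<beta> by (intro eq_vecI) (auto simp: j_def)
      then show False
        using \<alpha>(2) by simp
    qed
    ultimately show ?thesis
      using \<beta>O by blast
  qed
  then have "\<alpha> $ n = 1" if "n < dim_vec \<alpha>" for n
    using that \<alpha>(1) \<alpha>\<beta> by simp
  then show ?thesis
    using norm0_eq_dim[of \<alpha>] \<alpha>(1) by simp
qed

text \<open>
  By parity indicativeness, the row sums of \<open>S\<close> are its diagonal entries, so the all-one vector is in the
  kernel.
\<close>
lemma zero_diag_imp_singular:
  assumes S: "S \<in> carrier_mat d d" and par: "parity_indicative S" and "diag_vec S = 0\<^sub>v d" "d \<ge> 1"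
  shows "vec_space.rank d S < d"
proof -
  let ?j = "vec d (\<lambda>_. 1 :: bit)"
  have "S $$ (i, i) = 0" if "i < d" for i
    using assms(3) S that by (auto simp: diag_vec_def vec_eq_iff)
  then have j: "?j \<in> mat_kernel S"
    using parity_indicative_row_sum[OF S par] by (simp add: mat_kernel_bit_iff[OF S])
  have "0\<^sub>v d \<in> mat_kernel S"
    by (simp add: mat_kernel_bit_iff[OF S])
  moreover have "?j \<noteq> 0\<^sub>v d"
    using assms(4) by (auto simp: vec_eq_iff Suc_le_eq)
  ultimately have "card (mat_kernel S) \<noteq> 1"
    using j by (metis card_1_singletonE singletonD)
  then have "vec_space.rank d S \<noteq> d"
    using card_mat_kernel_bit[OF S] by auto
  then show ?thesis
    using rank_bit_le_rows[OF S] by simp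
qed

theorem theorem4p15:
  fixes d K :: nat and S :: "bit mat" and \<alpha> :: "bit vec"
  assumes "d \<ge> 1"
    and "S \<in> carrier_mat d d"
    and "transpose_mat S = S"
    and "parity_indicative S"
    and "K = 2 * d - vec_space.rank d S"
    and "\<alpha> \<in> carrier_vec K"
    and "\<alpha> \<noteq> 0\<^sub>v K"
    and "of_nat (norm0 \<alpha>) = trace_mat S"
  shows
    "(\<forall>fs. binary_frame d fs \<and> length fs = K \<and> frame_operator d fs = S
        \<longrightarrow> minimal_frame d fs)
     \<and>
     (diag_vec S \<noteq> 0\<^sub>v d \<longrightarrow>
        (vec_space.rank d S = d \<longrightarrow>
           (\<exists>fs. binary_frame d fs \<and> length fs = K \<and> S = frame_operator d fs
                 \<and> (\<forall>i<K. fs ! i \<bullet> fs ! i = \<alpha> $ i))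
           \<longrightarrow> norm0 \<alpha> = K)
        \<and>
        (vec_space.rank d S < d \<longrightarrow>
           (\<exists>fs. binary_frame d fs \<and> length fs = K \<and> minimal_frame d fs
                 \<and> S = frame_operator d fs
                 \<and> (\<forall>i<K. fs ! i \<bullet> fs ! i = \<alpha> $ i))))
     \<and>
     (diag_vec S = 0\<^sub>v d \<longrightarrow>
        vec_space.rank d S < d
        \<and>
        (vec_space.rank d S = d - 1 \<longrightarrow>
           (\<exists>fs. binary_frame d fs \<and> length fs = K \<and> S = frame_operator d fs
                 \<and> (\<forall>i<K. fs ! i \<bullet> fs ! i = \<alpha> $ i))
           \<longrightarrow> norm0 \<alpha> = K)
        \<and>
        (vec_space.rank d S < d - 1 \<longrightarrow>
           (\<exists>fs. binary_frame d fs \<and> length fs = K \<and> minimal_frame d fs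
                 \<and> S = frame_operator d fs
                 \<and> (\<forall>i<K. fs ! i \<bullet> fs ! i = \<alpha> $ i))))"
proof (intro conjI impI allI)
  fix fs assume "binary_frame d fs \<and> length fs = K \<and> frame_operator d fs = S"
  then show "minimal_frame d fs"
    using minimal_frame_of_length[OF assms(2)] assms(5) by blast
next
  assume "vec_space.rank d S = d"
  moreover assume "\<exists>fs. binary_frame d fs \<and> length fs = K \<and> S = frame_operator d fs
                 \<and> (\<forall>i<K. fs ! i \<bullet> fs ! i = \<alpha> $ i)"
  ultimately show "norm0 \<alpha> = K"
    using frame_norms_all_one[OF assms(2,4,6,7)] assms(5) by auto
next
  assume "diag_vec S = 0\<^sub>v d" "vec_space.rank d S = d - 1"
  moreover assume "\<exists>fs. binary_frame d fs \<and> length fs = K \<and> S = frame_operator d fs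
                 \<and> (\<forall>i<K. fs ! i \<bullet> fs ! i = \<alpha> $ i)"
  moreover have "K = d + 1"
    using assms(1,5) calculation(2) by simp
  ultimately show "norm0 \<alpha> = K"
    using frame_norms_all_one[OF assms(2,4,6,7)] by blast
next
  assume "diag_vec S = 0\<^sub>v d"
  then show "vec_space.rank d S < d"
    using zero_diag_imp_singular assms by blast
next
  assume "diag_vec S \<noteq> 0\<^sub>v d" "vec_space.rank d S < d"
  then show "\<exists>fs. binary_frame d fs \<and> length fs = K \<and> minimal_frame d fs
      \<and> S = frame_operator d fs \<and> (\<forall>i<K. fs ! i \<bullet> fs ! i = \<alpha> $ i)"
    using minimal_frame_with_norms[OF assms(2-8)] by blast
next
  assume "vec_space.rank d S < d - 1"
  then show "\<exists>fs. binary_frame d fs \<and> length fs = K \<and> minimal_frame d fs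
      \<and> S = frame_operator d fs \<and> (\<forall>i<K. fs ! i \<bullet> fs ! i = \<alpha> $ i)"
    using minimal_frame_with_norms[OF assms(2-8)] by simp
qed

end
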